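(* Let $a_1,\ldots,a_n,b_1,\ldots,b_n$ be positive integers and let $M$ be the nested matroid $$U_{a_1,a_1+b_1}\mathbin{\Box} U_{a_2,a_2+b_2}\mathbin{\Box}\cdots\mathbin{\Box} U_{a_n,a_n+b_n}.$$ If $a_i\ge a_{i+1}$ and $b_{i+1}\ge b_i$ for some $i\in[n-1]$, then $M$ is not extremal.
   Context: $[n]=\{1,\ldots,n\}$. $U_{r,n}$ is the uniform matroid of rank $r$ on $n$ elements (the factors are taken on pairwise disjoint ground sets). For matroids $M,N$ on disjoint ground sets, the free product $M\mathbin{\Box}N$ is the matroid on $E(M)\cup E(N)$ whose independent sets are the sets $I\cup J$ where $I$ is independent in $M$, $J\subseteq E(N)$, and $|I\cup J|\le r(M)+r_N(J)$. This operation is associative. For a matroid $M$ on $[n]$, $\mathcal{P}(M)\subset\mathbb{R}^n$ is the convex hull of the characteristic vectors of the bases of $M$. For $X\subseteq\mathbb{R}^n$ with indicator function $\bar{\mathbb{I}}(X)$, the symmetrized indicator function is $\mathbb{I}(X)(x_1,\ldots,x_n)=\frac{1}{n!}\sum_{\sigma\in S_n}\bar{\mathbb{I}}(X)(x_{\sigma(1)},\ldots,x_{\sigma(n)})$. $\mathbb{I}(\mathcal{P}(M))$ depends only on the isomorphism class of $M$, so it is defined for matroids on any $n$-element ground set and for unlabeled matroids (isomorphism classes). A cyclic flat of $M$ is a flat that is a (possibly empty) union of circuits; $M$ is nested if its cyclic flats form a chain under inclusion. Fix a linear order $N_1,\ldots,N_{\binom nr}$ of the unlabeled rank-$r$ nested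 matroids on $n$ elements. By a theorem of Derksen and Fink, for each rank-$r$ matroid $M$ on $n$ elements there is a unique integer vector $\boldsymbol{v}_M=(v_1,\ldots,v_{\binom nr})$ with $\mathbb{I}(\mathcal{P}(M))=\sum_i v_i\,\mathbb{I}(\mathcal{P}(N_i))$. The polytope $\Omega_{r,n}$ is the convex hull of all vectors $\boldsymbol{v}_M$, $M$ ranging over rank-$r$ matroids on $n$ elements. $M$ is extremal if $\boldsymbol{v}_M$ is a vertex of $\Omega_{r,n}$. *)

theory Defs
  imports "HOL-Analysis.Analysis"
begin

section \<open>Finite matroids\<close>

record 'a matroid =
  ground :: "'a set"
  indep :: "'a set \<Rightarrow> bool"

definition is_matroid :: "'a matroid \<Rightarrow> bool" where
  "is_matroid M \<longleftrightarrow>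
     finite (ground M) \<and>
     (\<forall>X. indep M X \<longrightarrow> X \<subseteq> ground M) \<and>
     indep M {} \<and>
     (\<forall>X Y. indep M Y \<and> X \<subseteq> Y \<longrightarrow> indep M X) \<and>
     (\<forall>X Y. indep M X \<and> indep M Y \<and> card X < card Y \<longrightarrow> (\<exists>y\<in>Y - X. indep M (insert y X)))"

definition rank_of :: "'a matroid \<Rightarrow> 'a set \<Rightarrow> nat" where
  "rank_of M X = Max (card ` {I. indep M I \<and> I \<subseteq> X})"

abbreviation matroid_rank :: "'a matroid \<Rightarrow> nat" where
  "matroid_rank M \<equiv> rank_of M (ground M)"

definition is_basis :: "'a matroid \<Rightarrow> 'a set \<Rightarrow> bool" where
  "is_basis M B \<longleftrightarrow> indep M B \<and> (\<forall>I. indep M I \<and> B \<subseteq> I \<longrightarrow> I = B)"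

definition circuit :: "'a matroid \<Rightarrow> 'a set \<Rightarrow> bool" where
  "circuit M C \<longleftrightarrow> C \<subseteq> ground M \<and> \<not> indep M C \<and> (\<forall>D. D \<subset> C \<longrightarrow> indep M D)"

definition flat :: "'a matroid \<Rightarrow> 'a set \<Rightarrow> bool" where
  "flat M F \<longleftrightarrow> F \<subseteq> ground M \<and> (\<forall>x\<in>ground M - F. rank_of M F < rank_of M (insert x F))"

definition cyclic_flat :: "'a matroid \<Rightarrow> 'a set \<Rightarrow> bool" where
  "cyclic_flat M F \<longleftrightarrow> flat M F \<and> (\<exists>\<C> \<subseteq> {C. circuit M C}. F = \<Union>\<C>)"

definition nested :: "'a matroid \<Rightarrow> bool" where
  "nested M \<longleftrightarrow> (\<forall>F G. cyclic_flat M F \<and> cyclic_flat M G \<longrightarrow> F \<subseteq> G \<or> G \<subseteq> F)"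

definition matroid_iso :: "'a matroid \<Rightarrow> 'b matroid \<Rightarrow> bool" where
  "matroid_iso M N \<longleftrightarrow>
     (\<exists>f. bij_betw f (ground M) (ground N) \<and>
          (\<forall>X. X \<subseteq> ground M \<longrightarrow> (indep M X \<longleftrightarrow> indep N (f ` X))))"

definition uniform_matroid :: "nat \<Rightarrow> 'a set \<Rightarrow> 'a matroid" where
  "uniform_matroid r E = \<lparr>ground = E, indep = (\<lambda>X. X \<subseteq> E \<and> card X \<le> r)\<rparr>"

definition free_product :: "'a matroid \<Rightarrow> 'a matroid \<Rightarrow> 'a matroid"  (infixl "\<box>" 65) where
  "M \<box> N =
     \<lparr>ground = ground M \<union> ground N,
      indep = (\<lambda>X. \<exists>I J. X = I \<union> J \<and> indep M I \<and> J \<subseteq> ground N \<and>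
                          card X \<le> matroid_rank M + rank_of N J)\<rparr>"


section \<open>Matroid polytopes and the polytope of all matroids\<close>

text \<open>
  An \<open>n\<close>-element ground set is the universe of a finite type \<open>'e\<close> with \<open>CARD('e) = n\<close>,
  so that the ambient space of the matroid polytope is \<open>real ^ 'e\<close>.
\<close>

definition matroids_of_rank :: "nat \<Rightarrow> 'e::finite matroid set" where
  "matroids_of_rank r = {M. is_matroid M \<and> ground M = UNIV \<and> matroid_rank M = r}"

definition char_vec :: "'e::finite set \<Rightarrow> real ^ 'e" where
  "char_vec B = (\<chi> e. indicator B e)"

definition matroid_polytope :: "'e::finite matroid \<Rightarrow> (real ^ 'e) set" where
  "matroid_polytope M = convex hull (char_vec ` {B. is_basis M B})"

definition sym_indicator :: "(real ^ 'e::finite) set \<Rightarrow> real ^ 'e \<Rightarrow> real" where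
  "sym_indicator X x =
     (1 / fact CARD('e)) * (\<Sum>\<sigma> | \<sigma> permutes (UNIV :: 'e set). indicator X (\<chi> e. x $ \<sigma> e))"

text \<open>
  \<open>N\<close> lists the unlabeled nested matroids of rank \<open>r\<close>: one labeled representative of each
  isomorphism class. The index type \<open>'k\<close> then has \<open>CARD('e) choose r\<close> elements, and plays the
  role of the positions in the chosen linear order.
\<close>

definition nested_enumeration :: "nat \<Rightarrow> ('k::finite \<Rightarrow> 'e::finite matroid) \<Rightarrow> bool" where
  "nested_enumeration r N \<longleftrightarrow>
     (\<forall>j. N j \<in> matroids_of_rank r \<and> nested (N j)) \<and>
     (\<forall>M \<in> matroids_of_rank r :: 'e matroid set. nested M \<longrightarrow> (\<exists>!j. matroid_iso M (N j)))"

text \<open>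
  When \<open>N\<close> enumerates the nested matroids of the rank of \<open>M\<close>, existence and uniqueness of the
  vector below are a theorem of Derksen and Fink.
\<close>

definition nested_vector :: "('k::finite \<Rightarrow> 'e::finite matroid) \<Rightarrow> 'e matroid \<Rightarrow> real ^ 'k" where
  "nested_vector N M =
     (THE v. (\<forall>j. v $ j \<in> \<int>) \<and>
             sym_indicator (matroid_polytope M) =
               (\<lambda>x. \<Sum>j\<in>UNIV. v $ j * sym_indicator (matroid_polytope (N j)) x))"

definition Omega :: "nat \<Rightarrow> ('k::finite \<Rightarrow> 'e::finite matroid) \<Rightarrow> (real ^ 'k) set" where
  "Omega r N = convex hull (nested_vector N ` matroids_of_rank r)"

definition extremal :: "('k::finite \<Rightarrow> 'e::finite matroid) \<Rightarrow> 'e matroid \<Rightarrow> bool" where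
  "extremal N M \<longleftrightarrow> nested_vector N M extreme_point_of Omega (matroid_rank M) N"

end

theory Submission
  imports Defs
begin

text \<open>
  Let \<open>F k = E 1 \<union> \<dots> \<union> E k\<close> and \<open>R k = a 1 + \<dots> + a k\<close>. The independent sets of \<open>M\<close> are the sets
  \<open>X\<close> with \<open>card (X \<inter> F k) \<le> R k\<close> for all \<open>k\<close>. Under the two inequalities on \<open>a\<close> and \<open>b\<close> there is a
  second set \<open>H\<close> with \<open>F (i - 1) \<subseteq> H \<subseteq> F (i + 1)\<close> and \<open>card H = card (F i)\<close> that meets \<open>E i\<close> in just
  \<open>a i - a (i + 1)\<close> elements. Let \<open>L\<close> be the matroid obtained from \<open>M\<close> by dropping the bound on
  \<open>F i\<close>, let \<open>M'\<close> be \<open>M\<close> with the bound on \<open>F i\<close> replaced by the same bound on \<open>H\<close>, and let \<open>K\<close> carry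
  both bounds. A point of the polytope of \<open>L\<close> cannot violate both bounds, since
  \<open>x(F i) + x(H) = x(F i \<union> H) + x(F i \<inter> H) \<le> R (i + 1) + R (i - 1) + (a i - a (i + 1)) = 2 R i\<close>.
  So the polytopes of \<open>M\<close> and \<open>M'\<close> cover that of \<open>L\<close> and intersect in that of \<open>K\<close>. Because
  \<open>M'\<close> is isomorphic to \<open>M\<close>, symmetrizing gives \<open>I(L) + I(K) = 2 I(M)\<close>, and the vector of \<open>M\<close> is
  the midpoint of the distinct vectors of \<open>L\<close> and \<open>K\<close> (\<open>capped_two_way_split\<close>,
  \<open>not_extremal_if_midpoint\<close>).

  Two facts support this. The first is an inequality description of the polytopes. Edmonds'
  description \<open>matroid_polytope_eq\<close> holds for every matroid; for a matroid given by cardinality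
  bounds it reduces to these bounds as soon as any two tight bounds lie below a common tight one
  (\<open>matroid_polytope_capped\<close>).

  The second is the linear independence of the symmetrized indicators of the nested matroids
  (\<open>nested_sym_indicators_independent\<close>), which makes the vectors well defined. It rests on
  the Euler characteristic: a linear relation between indicators of compact convex sets remains
  true when each indicator is replaced by 1 or 0 according to whether the set is nonempty
  (\<open>sum_coefficients_nonempty_zero\<close>). Intersecting the polytopes with regions that bound the
  mass on the cyclic flats of a nested matroid \<open>N\<close> from below isolates the matroids that have
  the same ranks as \<open>N\<close> on these flats. All of them have at most the independent sets of
  \<open>N\<close>. Hence, if \<open>N\<close> has as few independent sets as possible among the matroids in a
  nontrivial relation, only copies of \<open>N\<close> remain, and its coefficient vanishes.
\<close>

section \<open>Rank, flag bases and cyclic flats\<close>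

lemma matroid_finite_ground: "is_matroid M \<Longrightarrow> finite (ground M)"
  and indep_subset_ground: "is_matroid M \<Longrightarrow> indep M X \<Longrightarrow> X \<subseteq> ground M"
  and indep_empty: "is_matroid M \<Longrightarrow> indep M {}"
  and indep_subset: "is_matroid M \<Longrightarrow> indep M Y \<Longrightarrow> X \<subseteq> Y \<Longrightarrow> indep M X"
  and indep_exchange: "is_matroid M \<Longrightarrow> indep M X \<Longrightarrow> indep M Y \<Longrightarrow> card X < card Y
         \<Longrightarrow> \<exists>y\<in>Y - X. indep M (insert y X)"
  unfolding is_matroid_def by blast+

lemma indep_finite: "is_matroid M \<Longrightarrow> indep M X \<Longrightarrow> finite X"
  by (meson finite_subset matroid_finite_ground indep_subset_ground)

lemma finite_indep_subsets: "is_matroid M \<Longrightarrow> finite {I. indep M I \<and> I \<subseteq> X}"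
  by (rule finite_subset[of _ "Pow (ground M)"])
     (auto simp: matroid_finite_ground dest: indep_subset_ground)

lemma card_le_rank_of:
  assumes "is_matroid M" "indep M I" "I \<subseteq> X"
  shows "card I \<le> rank_of M X"
  unfolding rank_of_def
  by (rule Max_ge) (use assms finite_indep_subsets in auto)

lemma rank_of_attained:
  assumes "is_matroid M"
  obtains I where "indep M I" "I \<subseteq> X" "card I = rank_of M X"
proof -
  have "rank_of M X \<in> card ` {I. indep M I \<and> I \<subseteq> X}"
    unfolding rank_of_def
    by (rule Max_in) (use assms finite_indep_subsets indep_empty in auto)
  then show ?thesis using that by auto
qed

lemma rank_of_mono:
  assumes "is_matroid M" "X \<subseteq> Y"
  shows "rank_of M X \<le> rank_of M Y"
  by (metis assms card_le_rank_of order_trans rank_of_attained)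

lemma rank_of_le_card:
  assumes "is_matroid M" "finite X"
  shows "rank_of M X \<le> card X"
  by (metis assms card_mono rank_of_attained)

lemma indep_extend_to_rank:
  assumes M: "is_matroid M" and "indep M I" "I \<subseteq> X"
  obtains J where "indep M J" "I \<subseteq> J" "J \<subseteq> X" "card J = rank_of M X"
proof -
  have "\<exists>J. indep M J \<and> I \<subseteq> J \<and> J \<subseteq> X \<and> card J = rank_of M X"
    using assms(2,3)
  proof (induction "rank_of M X - card I" arbitrary: I rule: less_induct)
    case less
    obtain K where K: "indep M K" "K \<subseteq> X" "card K = rank_of M X"
      using rank_of_attained[OF M] .
    show ?case
    proof (cases "card I = rank_of M X")
      case True
      then show ?thesis using less.prems by blast
    next
      case False
      then have lt: "card I < rank_of M X"
        using card_le_rank_of[OF M less.prems] by simp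
      then obtain y where y: "y \<in> K - I" "indep M (insert y I)"
        using indep_exchange[OF M less.prems(1) K(1)] K(3) by auto
      have "card (insert y I) = Suc (card I)"
        using y indep_finite[OF M less.prems(1)] by simp
      then have "\<exists>J. indep M J \<and> insert y I \<subseteq> J \<and> J \<subseteq> X \<and> card J = rank_of M X"
        using less.hyps[of "insert y I"] y K(2) less.prems(2) lt by auto
      then show ?thesis by blast
    qed
  qed
  then show ?thesis using that by blast
qed

text \<open>
  Extend an independent set greedily along the chain: an extension to a larger member
  keeps the smaller intersections, which are already of maximal size.
\<close>

lemma flag_basis:
  assumes M: "is_matroid M" and "finite \<C>" "\<And>F. F \<in> \<C> \<Longrightarrow> finite F"
    and "\<And>F G. F \<in> \<C> \<Longrightarrow> G \<in> \<C> \<Longrightarrow> F \<subseteq> G \<or> G \<subseteq> F"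
  shows "\<exists>B. indep M B \<and> B \<subseteq> \<Union>\<C> \<and> (\<forall>F\<in>\<C>. card (B \<inter> F) = rank_of M F)"
  using assms(2-)
proof (induction \<C> rule: finite_ranking_induct[where f = card])
  case empty
  then show ?case using indep_empty[OF M] by auto
next
  case (insert G \<C>)
  then obtain I where I: "indep M I" "I \<subseteq> \<Union>\<C>" "\<And>F. F \<in> \<C> \<Longrightarrow> card (I \<inter> F) = rank_of M F"
    by (metis insertCI)
  have sub: "F \<subseteq> G" if "F \<in> \<C>" for F
    using insert.prems(1)[of F] insert.prems(2)[of F G] insert.hyps(2)[OF that] that
    by (metis card_seteq insertCI order_refl)
  then have "I \<subseteq> G" using I(2) by blast
  then obtain J where J: "indep M J" "I \<subseteq> J" "J \<subseteq> G" "card J = rank_of M G"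
    using indep_extend_to_rank[OF M I(1)] by metis
  have "card (J \<inter> F) = rank_of M F" if "F \<in> \<C>" for F
  proof (rule antisym)
    show "card (J \<inter> F) \<le> rank_of M F"
      by (rule card_le_rank_of[OF M indep_subset[OF M J(1)]]) auto
    show "rank_of M F \<le> card (J \<inter> F)"
      unfolding I(3)[OF that, symmetric]
      by (rule card_mono) (use J(2) indep_finite[OF M J(1)] in auto)
  qed
  then show ?case using J by (intro exI[of _ J]) (auto simp: Int_absorb2)
qed

lemma is_basis_iff_card:
  assumes M: "is_matroid M"
  shows "is_basis M B \<longleftrightarrow> indep M B \<and> card B = matroid_rank M"
proof (intro iffI conjI)
  assume B: "is_basis M B"
  then show "indep M B" by (simp add: is_basis_def)
  then obtain J where "indep M J" "B \<subseteq> J" "card J = matroid_rank M"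
    using indep_extend_to_rank[OF M _ indep_subset_ground[OF M]] by metis
  then show "card B = matroid_rank M" using B by (auto simp: is_basis_def)
next
  assume B: "indep M B \<and> card B = matroid_rank M"
  show "is_basis M B"
    unfolding is_basis_def
  proof (intro conjI allI impI)
    show "indep M B" using B by simp
    fix I assume I: "indep M I \<and> B \<subseteq> I"
    then have "card I \<le> card B"
      using B card_le_rank_of[OF M _ indep_subset_ground[OF M]] by metis
    then show "I = B" using I card_seteq indep_finite[OF M] by metis
  qed
qed

lemma dependent_contains_circuit:
  assumes M: "is_matroid M" and X: "X \<subseteq> ground M" "\<not> indep M X"
  obtains C where "circuit M C" "C \<subseteq> X"
proof -
  let ?A = "{Y. Y \<subseteq> X \<and> \<not> indep M Y}"
  have fin: "finite ?A"
    by (rule finite_subset[OF _ finite_Pow_iff[THEN iffD2, OF matroid_finite_ground[OF M]]])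
       (use X(1) in auto)
  have "?A \<noteq> {}" using X(2) by auto
  from finite_has_minimal[OF fin this]
  obtain C where C: "C \<in> ?A" and min: "\<forall>D\<in>?A. D \<subseteq> C \<longrightarrow> C = D" ..
  have "indep M D" if "D \<subset> C" for D
    using min[rule_format, of D] that C by auto
  then have "circuit M C" using C X(1) by (auto simp: circuit_def)
  then show ?thesis using that C(1) by blast
qed

lemma circuit_nonempty: "is_matroid M \<Longrightarrow> circuit M C \<Longrightarrow> C \<noteq> {}"
  using indep_empty unfolding circuit_def by metis

lemma circuit_remove_indep:
  assumes "circuit M C" "c \<in> C"
  shows "indep M (C - {c})"
proof -
  have "C - {c} \<subset> C" using assms(2) by auto
  then show ?thesis using assms(1) unfolding circuit_def by simp
qed

text \<open>
  The closure of a circuit \<open>C\<close> is covered by circuits: for \<open>x\<close> in the closure but not in \<open>C\<close> and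
  \<open>c \<in> C\<close>, the set \<open>C - {c}\<close> spans the closure, so it becomes dependent when \<open>x\<close> is added.
\<close>

lemma closure_of_circuit_is_cyclic_flat:
  assumes M: "is_matroid M" and C: "circuit M C"
  obtains F where "cyclic_flat M F" "C \<subseteq> F" "rank_of M F < card C"
proof -
  define F where "F = {x \<in> ground M. rank_of M (insert x C) = rank_of M C}"
  have CF: "C \<subseteq> F"
    using C by (auto simp: F_def circuit_def insert_absorb)
  have finC: "finite C"
    using C matroid_finite_ground[OF M] finite_subset unfolding circuit_def by blast
  obtain I where I: "indep M I" "I \<subseteq> C" "card I = rank_of M C"
    using rank_of_attained[OF M] .
  have "I \<noteq> C" using C I by (auto simp: circuit_def)
  then have ltC: "rank_of M C < card C"
    using I finC by (metis psubsetI psubset_card_mono)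
  have rF: "rank_of M F = rank_of M C"
  proof (rule antisym)
    show "rank_of M F \<le> rank_of M C"
    proof (rule ccontr)
      assume "\<not> ?thesis"
      moreover obtain J where J: "indep M J" "J \<subseteq> F" "card J = rank_of M F"
        using rank_of_attained[OF M] .
      ultimately obtain y where y: "y \<in> J - I" "indep M (insert y I)"
        using indep_exchange[OF M I(1), of J] I by auto
      then have "Suc (rank_of M C) \<le> rank_of M (insert y C)"
        using card_le_rank_of[OF M y(2), of "insert y C"] I indep_finite[OF M I(1)] by auto
      then show False using y J by (auto simp: F_def)
    qed
  qed (rule rank_of_mono[OF M CF])
  have "flat M F"
    unfolding flat_def
  proof (intro conjI ballI)
    fix x assume "x \<in> ground M - F"
    then have "rank_of M (insert x C) \<noteq> rank_of M C" by (auto simp: F_def)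
    moreover have "rank_of M C \<le> rank_of M (insert x C)" "rank_of M (insert x C) \<le> rank_of M (insert x F)"
      using CF by (auto intro!: rank_of_mono[OF M])
    ultimately show "rank_of M F < rank_of M (insert x F)" using rF by simp
  qed (auto simp: F_def)
  moreover have "\<exists>D. circuit M D \<and> D \<subseteq> F \<and> x \<in> D" if x: "x \<in> F" for x
  proof (cases "x \<in> C")
    case True
    then show ?thesis using C CF by blast
  next
    case False
    obtain c where c: "c \<in> C" using circuit_nonempty[OF M C] by blast
    then have ind: "indep M (C - {c})" by (rule circuit_remove_indep[OF C])
    have "\<not> indep M (insert x (C - {c}))"
    proof
      assume "indep M (insert x (C - {c}))"
      then have "card (insert x (C - {c})) \<le> rank_of M (insert x C)"
        by (rule card_le_rank_of[OF M]) auto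
      moreover have "card (insert x (C - {c})) = card C"
        using False c finC card_Suc_Diff1[OF finC c] by simp
      ultimately show False using x ltC by (simp add: F_def)
    qed
    moreover have "insert x (C - {c}) \<subseteq> ground M"
      using x CF by (auto simp: F_def)
    ultimately obtain D where D: "circuit M D" "D \<subseteq> insert x (C - {c})"
      using dependent_contains_circuit[OF M] by metis
    have "x \<in> D"
    proof (rule ccontr)
      assume "x \<notin> D"
      then have "D \<subseteq> C - {c}" using D(2) by blast
      then show False using D(1) indep_subset[OF M ind] by (auto simp: circuit_def)
    qed
    then show ?thesis using D x CF by blast
  qed
  then have "F = \<Union>{D. circuit M D \<and> D \<subseteq> F}" by blast
  ultimately have "cyclic_flat M F"
    unfolding cyclic_flat_def by (metis (no_types, lifting) Collect_mono)
  then show ?thesis using that CF rF ltC by simp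
qed

text \<open>
  A dependent set violates the bound of the closure of any circuit that it contains. So the cyclic
  flats and their ranks determine the matroid.
\<close>

lemma indep_if_cyclic_flat_bounds:
  assumes M: "is_matroid M" and X: "X \<subseteq> ground M"
    and le: "\<And>F. cyclic_flat M F \<Longrightarrow> card (X \<inter> F) \<le> rank_of M F"
  shows "indep M X"
proof (rule ccontr)
  assume "\<not> indep M X"
  then obtain C where C: "circuit M C" "C \<subseteq> X"
    using dependent_contains_circuit[OF M X] by metis
  then obtain F where F: "cyclic_flat M F" "C \<subseteq> F" "rank_of M F < card C"
    using closure_of_circuit_is_cyclic_flat[OF M] by metis
  have "card C \<le> card (X \<inter> F)"
    using C(2) F(2) finite_subset[OF X matroid_finite_ground[OF M]] by (intro card_mono) auto
  then show False using le[OF F(1)] F(3) by simp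
qed

section \<open>Linear relations between indicators of compact convex sets\<close>

text \<open>
  Comparing the relation at \<open>t\<close> with the relation just to the right of \<open>t\<close>, only the intervals
  that end at \<open>t\<close> make a difference. So the coefficients of the intervals with a given right end
  point already cancel.
\<close>

lemma interval_sum_zero:
  fixes c l u :: "'i \<Rightarrow> real"
  assumes fin: "finite I" and lu: "\<And>i. i \<in> I \<Longrightarrow> l i \<le> u i"
    and zero: "\<And>t. (\<Sum>i\<in>{i\<in>I. l i \<le> t \<and> t \<le> u i}. c i) = 0"
  shows "sum c I = 0"
proof -
  have "sum c {i\<in>I. u i = t} = 0" for t
  proof -
    \<comment> \<open>\<open>s\<close> is so close to \<open>t\<close> that no end point lies in the interval from \<open>t\<close> (exclusive) to \<open>s\<close>.\<close>
    let ?E = "{x \<in> l ` I \<union> u ` I. t < x}"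
    obtain s where s: "t < s" "\<And>x. x \<in> ?E \<Longrightarrow> s < x"
    proof (cases "?E = {}")
      case True
      then show ?thesis using that[of "t + 1"] by auto
    next
      case False
      have fE: "finite ?E" using fin by auto
      then have "t < Min ?E" using Min_in[OF fE False] by auto
      then obtain s where "t < s" "s < Min ?E" using dense by blast
      then show ?thesis using that[of s] Min_le[OF fE] by (meson less_le_trans)
    qed
    have l: "l i \<le> s \<longleftrightarrow> l i \<le> t" and u: "s \<le> u i \<longleftrightarrow> t < u i" if "i \<in> I" for i
      using s that by force+
    have "{i\<in>I. l i \<le> t \<and> t \<le> u i} = {i\<in>I. l i \<le> s \<and> s \<le> u i} \<union> {i\<in>I. u i = t}"
      using l u lu by force
    moreover have "{i\<in>I. l i \<le> s \<and> s \<le> u i} \<inter> {i\<in>I. u i = t} = {}"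
      using u by auto
    ultimately have "sum c {i\<in>I. l i \<le> t \<and> t \<le> u i}
        = sum c {i\<in>I. l i \<le> s \<and> s \<le> u i} + sum c {i\<in>I. u i = t}"
      using fin by (simp add: sum.union_disjoint)
    then show ?thesis using zero by simp
  qed
  then show ?thesis using sum.image_gen[OF fin, of c u] by simp
qed

text \<open>
  Induction on the set \<open>S\<close> of coordinates in which the sets may extend. By the induction hypothesis
  the claim holds on every slice orthogonal to a new coordinate \<open>b\<close>. The values of \<open>b\<close> whose slice
  of \<open>K i\<close> is nonempty form a compact interval, which leaves the one-dimensional case.
\<close>

lemma sum_coefficients_nonempty_zero_slice:
  fixes K :: "'i \<Rightarrow> 'a::euclidean_space set" and c :: "'i \<Rightarrow> real"
  assumes fin: "finite I" and "finite S" "S \<subseteq> Basis"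
    and "\<forall>i\<in>I. compact (K i) \<and> convex (K i)"
    and "\<forall>x. (\<Sum>i\<in>{i\<in>I. x \<in> K i}. c i) = 0"
    and "\<forall>i\<in>I. \<forall>x\<in>K i. \<forall>b\<in>Basis - S. x \<bullet> b = p \<bullet> b"
  shows "(\<Sum>i\<in>{i\<in>I. K i \<noteq> {}}. c i) = 0"
  using assms(2-)
proof (induction S arbitrary: K p rule: finite_induct)
  case empty
  have "x = p" if "i \<in> I" "x \<in> K i" for i x
    using empty.prems(4) that by (simp add: euclidean_eq_iff[where 'a = 'a])
  then have "{i\<in>I. K i \<noteq> {}} = {i\<in>I. p \<in> K i}" by blast
  then show ?case using empty.prems(3) by simp
next
  case (insert b S)
  define J where "J = {i\<in>I. K i \<noteq> {}}"
  define L where "L i = (\<lambda>x. x \<bullet> b) ` K i" for i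
  have "\<exists>l u. L i = {l..u}" if "i \<in> J" for i
  proof -
    have K: "compact (K i)" "connected (K i)"
      using insert.prems(2) that convex_connected by (auto simp: J_def)
    have cont: "continuous_on (K i) (\<lambda>x. x \<bullet> b)" by (intro continuous_intros)
    show ?thesis unfolding L_def
      using compact_continuous_image[OF cont K(1)] connected_continuous_image[OF cont K(2)]
        connected_compact_interval_1 by blast
  qed
  then obtain l u where L: "\<And>i. i \<in> J \<Longrightarrow> L i = {l i..u i}" by metis
  have lu: "l i \<le> u i" if "i \<in> J" for i
    using L[OF that] that by (auto simp: L_def J_def)
  have "(\<Sum>i\<in>{i\<in>J. l i \<le> t \<and> t \<le> u i}. c i) = 0" for t
  proof -
    let ?H = "{x. x \<bullet> b = t}"
    have H: "closed ?H" "convex ?H"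
      using closed_hyperplane[of b t] convex_hyperplane[of b t] by (simp_all add: inner_commute)
    have "(l i \<le> t \<and> t \<le> u i) \<longleftrightarrow> K i \<inter> ?H \<noteq> {}" if "i \<in> J" for i
    proof -
      have "(l i \<le> t \<and> t \<le> u i) \<longleftrightarrow> t \<in> L i" using L[OF that] by simp
      then show ?thesis by (auto simp: L_def)
    qed
    then have "{i\<in>J. l i \<le> t \<and> t \<le> u i} = {i\<in>I. K i \<inter> ?H \<noteq> {}}"
      by (auto simp: J_def)
    moreover have "(\<Sum>i\<in>{i\<in>I. K i \<inter> ?H \<noteq> {}}. c i) = 0"
    proof (rule insert.IH[of "\<lambda>i. K i \<inter> ?H" "p + (t - p \<bullet> b) *\<^sub>R b"])
      show "S \<subseteq> Basis" using insert.prems(1) by simp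
      show "\<forall>i\<in>I. compact (K i \<inter> ?H) \<and> convex (K i \<inter> ?H)"
        using insert.prems(2) H by (simp add: compact_Int_closed convex_Int)
      show "\<forall>x. (\<Sum>i\<in>{i\<in>I. x \<in> K i \<inter> ?H}. c i) = 0"
      proof
        fix x
        show "(\<Sum>i\<in>{i\<in>I. x \<in> K i \<inter> ?H}. c i) = 0"
          using insert.prems(3) by (cases "x \<bullet> b = t") auto
      qed
      show "\<forall>i\<in>I. \<forall>x\<in>K i \<inter> ?H. \<forall>d\<in>Basis - S. x \<bullet> d = (p + (t - p \<bullet> b) *\<^sub>R b) \<bullet> d"
      proof (intro ballI)
        fix i x d assume i: "i \<in> I" "x \<in> K i \<inter> ?H" and d: "d \<in> Basis - S"
        show "x \<bullet> d = (p + (t - p \<bullet> b) *\<^sub>R b) \<bullet> d"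
        proof (cases "d = b")
          case True
          then show ?thesis using i insert.prems(1) by (simp add: inner_add_left)
        next
          case False
          then have "b \<bullet> d = 0" using d insert.prems(1) by (simp add: inner_not_same_Basis)
          then show ?thesis using i d False insert.prems(4) by (simp add: inner_add_left)
        qed
      qed
    qed
    ultimately show ?thesis by simp
  qed
  then have "sum c J = 0"
    using interval_sum_zero[of J l u c] fin lu by (simp add: J_def)
  then show ?case by (simp add: J_def)
qed

text \<open>
  The Euler characteristic, which is 1 on every nonempty compact convex set, is a well-defined
  linear functional on the span of the indicators of these sets.
\<close>

lemma sum_coefficients_nonempty_zero:
  fixes K :: "'i \<Rightarrow> 'a::euclidean_space set" and c :: "'i \<Rightarrow> real"
  assumes "finite I" "\<And>i. i \<in> I \<Longrightarrow> compact (K i)" "\<And>i. i \<in> I \<Longrightarrow> convex (K i)"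
    and "\<And>x. (\<Sum>i\<in>{i\<in>I. x \<in> K i}. c i) = 0"
  shows "(\<Sum>i\<in>{i\<in>I. K i \<noteq> {}}. c i) = 0"
  by (rule sum_coefficients_nonempty_zero_slice[of I Basis K c 0]) (use assms in auto)

section \<open>Edmonds' description of the matroid polytope\<close>

abbreviation mass :: "real ^ 'e::finite \<Rightarrow> 'e set \<Rightarrow> real" where
  "mass x S \<equiv> (\<Sum>e\<in>S. x $ e)"

lemma mass_char_vec: "mass (char_vec B) S = card (B \<inter> S)"
  by (simp add: char_vec_def indicator_def sum.If_cases Int_commute)

lemma linear_mass: "linear (\<lambda>x. mass x S)"
  by (rule linearI) (simp_all add: sum.distrib sum_distrib_left)

text \<open>
  The weighted sum is a combination of sums of \<open>z\<close> over upper level sets of \<open>w\<close>, with nonnegative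
  coefficients except on the whole space, where the sum is zero. The proof removes one level at a
  time, by lowering the maximum of \<open>w\<close> to its second largest value.
\<close>

lemma weighted_sum_nonpos:
  fixes w z :: "'e::finite \<Rightarrow> real"
  assumes "sum z UNIV = 0" "\<And>t. sum z {e. t \<le> w e} \<le> 0"
  shows "(\<Sum>e\<in>UNIV. w e * z e) \<le> 0"
  using assms(2)
proof (induction "card (range w)" arbitrary: w rule: less_induct)
  case less
  define m where "m = Max (range w)"
  have m: "m \<in> range w" "\<And>e. w e \<le> m" by (auto simp: m_def intro: Max_in)
  show ?case
  proof (cases "range w = {m}")
    case True
    then have "w e = m" for e by blast
    then show ?thesis using assms(1) by (simp add: sum_distrib_left[symmetric])
  next
    case False
    define m' where "m' = Max (range w - {m})"
    have ne: "range w - {m} \<noteq> {}" using False m(1) by blast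
    then have m'in: "m' \<in> range w - {m}" unfolding m'_def by (intro Max_in) auto
    have m'max: "w e \<le> m'" if "w e \<noteq> m" for e
      unfolding m'_def using that by (intro Max_ge) auto
    have m'm: "m' < m" using m'in m(2) by (metis Diff_iff imageE insertCI order_le_imp_less_or_eq)
    define w' where "w' e = min (w e) m'" for e
    have "range w' \<subseteq> range w - {m}"
    proof
      fix y assume "y \<in> range w'"
      then obtain e where y: "y = min (w e) m'" by (auto simp: w'_def)
      show "y \<in> range w - {m}"
      proof (cases "w e = m")
        case True
        then show ?thesis using y m'in m'm by (simp add: min_def)
      next
        case False
        then show ?thesis using y m'max[OF False] by (simp add: min_def)
      qed
    qed
    then have "card (range w') < card (range w)"
      using m(1) by (intro psubset_card_mono) auto
    moreover have "sum z {e. t \<le> w' e} \<le> 0" for t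
      using less.prems[of t] by (cases "t \<le> m'") (auto simp: w'_def)
    ultimately have IH: "(\<Sum>e\<in>UNIV. w' e * z e) \<le> 0" by (rule less.hyps)
    have "w e * z e = w' e * z e + (m - m') * (if m \<le> w e then z e else 0)" for e
    proof (cases "w e = m")
      case True
      then show ?thesis using m'm by (simp add: w'_def min_def algebra_simps)
    next
      case False
      then show ?thesis using m'max[OF False] m(2)[of e] by (simp add: w'_def min_def)
    qed
    then have "(\<Sum>e\<in>UNIV. w e * z e)
        = (\<Sum>e\<in>UNIV. w' e * z e) + (m - m') * (\<Sum>e\<in>UNIV. if m \<le> w e then z e else 0)"
      by (simp add: sum.distrib sum_distrib_left)
    also have "(\<Sum>e\<in>UNIV. if m \<le> w e then z e else 0) = sum z {e. m \<le> w e}"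
      by (simp add: sum.If_cases)
    finally show ?thesis
      using IH mult_nonneg_nonpos[of "m - m'" "sum z {e. m \<le> w e}"] less.prems[of m] m'm by simp
  qed
qed

text \<open>
  Suppose a point satisfies the inequalities but is separated from the polytope by a weight \<open>w\<close>. A
  basis that attains the rank of every upper level set of \<open>w\<close> (a greedy basis) has at least as much
  weight as the point, a contradiction.
\<close>

lemma matroid_polytope_eq:
  fixes M :: "'e::finite matroid"
  assumes "M \<in> matroids_of_rank r"
  shows "matroid_polytope M = {x. mass x UNIV = r \<and> (\<forall>S. mass x S \<le> rank_of M S)}"
proof -
  have M: "is_matroid M" "matroid_rank M = r" "ground M = UNIV"
    using assms by (auto simp: matroids_of_rank_def)
  show ?thesis
  proof (intro equalityI subsetI)
    fix x assume "x \<in> matroid_polytope M"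
    moreover have "matroid_polytope M \<subseteq> (\<lambda>x. mass x UNIV) -` {real r} \<inter> (\<Inter>S. (\<lambda>x. mass x S) -` {..real (rank_of M S)})"
      unfolding matroid_polytope_def
    proof (rule hull_minimal)
      show "char_vec ` {B. is_basis M B} \<subseteq> (\<lambda>x. mass x UNIV) -` {real r} \<inter> (\<Inter>S. (\<lambda>x. mass x S) -` {..real (rank_of M S)})"
      proof (rule image_subsetI)
        fix B assume "B \<in> {B. is_basis M B}"
        then have B: "indep M B" "card B = r" using M is_basis_iff_card[OF M(1)] by auto
        have "card (B \<inter> S) \<le> rank_of M S" for S
          by (rule card_le_rank_of[OF M(1) indep_subset[OF M(1) B(1)]]) auto
        then show "char_vec B \<in> (\<lambda>x. mass x UNIV) -` {real r} \<inter> (\<Inter>S. (\<lambda>x. mass x S) -` {..real (rank_of M S)})"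
          using B by (simp add: mass_char_vec)
      qed
      show "convex ((\<lambda>x. mass x UNIV) -` {real r} \<inter> (\<Inter>S. (\<lambda>x. mass x S) -` {..real (rank_of M S)}))"
        by (intro convex_Int convex_INT convex_linear_vimage linear_mass) auto
    qed
    ultimately show "x \<in> {x. mass x UNIV = r \<and> (\<forall>S. mass x S \<le> rank_of M S)}" by auto
  next
    fix x assume x: "x \<in> {x. mass x UNIV = r \<and> (\<forall>S. mass x S \<le> rank_of M S)}"
    show "x \<in> matroid_polytope M"
    proof (rule ccontr)
      assume "x \<notin> matroid_polytope M"
      moreover have "convex (matroid_polytope M)" "closed (matroid_polytope M)"
        unfolding matroid_polytope_def
        by (auto intro!: compact_imp_closed finite_imp_compact_convex_hull)
      ultimately obtain a b where ab: "a \<bullet> x < b" "\<forall>y\<in>matroid_polytope M. b < a \<bullet> y"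
        using separating_hyperplane_closed_point by blast
      define w where "w e = - (a $ e)" for e
      define \<C> where "\<C> = insert UNIV (range (\<lambda>t. {e. t \<le> w e}))"
      have "\<exists>B. indep M B \<and> B \<subseteq> \<Union>\<C> \<and> (\<forall>F\<in>\<C>. card (B \<inter> F) = rank_of M F)"
        by (rule flag_basis[OF M(1)]) (auto simp: \<C>_def)
      then obtain B where B: "indep M B" "\<And>F. F \<in> \<C> \<Longrightarrow> card (B \<inter> F) = rank_of M F" by blast
      have cB: "card B = r" using B(2)[of UNIV] M by (simp add: \<C>_def)
      then have "is_basis M B" using B M is_basis_iff_card[OF M(1)] by auto
      then have inP: "char_vec B \<in> matroid_polytope M"
        by (auto simp: matroid_polytope_def intro: hull_inc)
      define z where "z e = x $ e - char_vec B $ e" for e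
      have "(\<Sum>e\<in>UNIV. w e * z e) \<le> 0"
      proof (rule weighted_sum_nonpos)
        show "sum z UNIV = 0"
          using x cB by (simp add: z_def sum_subtractf mass_char_vec)
        fix t
        have "card (B \<inter> {e. t \<le> w e}) = rank_of M {e. t \<le> w e}"
          by (rule B(2)) (simp add: \<C>_def)
        then show "sum z {e. t \<le> w e} \<le> 0"
          using x by (simp add: z_def sum_subtractf mass_char_vec)
      qed
      then have "a \<bullet> char_vec B \<le> a \<bullet> x"
        by (simp add: w_def z_def inner_vec_def algebra_simps sum_subtractf)
      then show False using ab inP by force
    qed
  qed
qed

section \<open>Matroids given by cardinality bounds\<close>

definition capped :: "('e::finite set \<times> nat) set \<Rightarrow> 'e matroid" where
  "capped \<C> = \<lparr>ground = UNIV, indep = (\<lambda>X. \<forall>(S, c)\<in>\<C>. card (X \<inter> S) \<le> c)\<rparr>"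

lemma ground_capped [simp]: "ground (capped \<C>) = UNIV"
  by (simp add: capped_def)

lemma indep_capped: "indep (capped \<C>) X \<longleftrightarrow> (\<forall>(S, c)\<in>\<C>. card (X \<inter> S) \<le> c)"
  by (simp add: capped_def)

text \<open>
  This condition is what makes a family of bounds behave like a chain: for every independent set,
  the tight sets, if there are any, have a largest member.
\<close>

definition tight_directed :: "('e::finite set \<times> nat) set \<Rightarrow> bool" where
  "tight_directed \<C> \<longleftrightarrow>
     (\<forall>X. indep (capped \<C>) X \<longrightarrow>
       (\<forall>(S, c)\<in>\<C>. \<forall>(T, d)\<in>\<C>. card (X \<inter> S) = c \<longrightarrow> card (X \<inter> T) = d \<longrightarrow>
         (\<exists>(U, u)\<in>\<C>. card (X \<inter> U) = u \<and> S \<subseteq> U \<and> T \<subseteq> U)))"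

lemma capped_subset_indep:
  fixes X Y :: "'e::finite set"
  assumes "indep (capped \<C>) Y" "X \<subseteq> Y"
  shows "indep (capped \<C>) X"
  unfolding indep_capped
proof (intro ballI, clarify)
  fix S c assume "(S, c) \<in> \<C>"
  then have "card (Y \<inter> S) \<le> c" using assms(1) by (auto simp: indep_capped)
  moreover have "card (X \<inter> S) \<le> card (Y \<inter> S)" using assms(2) by (intro card_mono) auto
  ultimately show "card (X \<inter> S) \<le> c" by simp
qed

text \<open>
  Each element of \<open>Y\<close> that cannot be added to \<open>X\<close> lies in a tight set, and directedness merges these
  tight sets into one.
\<close>

lemma capped_saturated:
  fixes X Y :: "'e::finite set"
  assumes dir: "tight_directed \<C>" and X: "indep (capped \<C>) X"
    and sat: "\<And>y. y \<in> Y - X \<Longrightarrow> \<not> indep (capped \<C>) (insert y X)"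
  obtains "Y \<subseteq> X" | T d where "(T, d) \<in> \<C>" "card (X \<inter> T) = d" "Y \<subseteq> X \<union> T"
proof (cases "Y - X = {}")
  case True
  then show ?thesis using that(1) by blast
next
  case False
  have single: "\<exists>T d. (T, d) \<in> \<C> \<and> card (X \<inter> T) = d \<and> y \<in> T" if y: "y \<in> Y - X" for y
  proof -
    obtain T d where T: "(T, d) \<in> \<C>" "\<not> card (insert y X \<inter> T) \<le> d"
      using sat[OF y] by (auto simp: indep_capped)
    moreover have le: "card (X \<inter> T) \<le> d" using X T(1) by (auto simp: indep_capped)
    ultimately have "y \<in> T" by (cases "y \<in> T") auto
    moreover have "card (X \<inter> T) = d"
      using T(2) le \<open>y \<in> T\<close> y by (simp add: Int_insert_left)
    ultimately show ?thesis using T(1) by blast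
  qed
  have "\<exists>T d. (T, d) \<in> \<C> \<and> card (X \<inter> T) = d \<and> Z \<subseteq> T"
    if "finite Z" "Z \<noteq> {}" "Z \<subseteq> Y - X" for Z
    using that
  proof (induction rule: finite_ne_induct)
    case (singleton y)
    then show ?case using single[of y] by auto
  next
    case (insert y Z)
    then obtain T d where T: "(T, d) \<in> \<C>" "card (X \<inter> T) = d" "Z \<subseteq> T" by auto
    obtain S c where S: "(S, c) \<in> \<C>" "card (X \<inter> S) = c" "y \<in> S"
      using single[of y] insert.prems by auto
    obtain U u where "(U, u) \<in> \<C>" "card (X \<inter> U) = u" "S \<subseteq> U" "T \<subseteq> U"
      using dir[unfolded tight_directed_def, rule_format, OF X S(1)] T S by fastforce
    then show ?case using T S by blast
  qed
  from this[of "Y - X"] obtain T d where "(T, d) \<in> \<C>" "card (X \<inter> T) = d" "Y - X \<subseteq> T"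
    using False by auto
  then show ?thesis using that(2)[of T d] by blast
qed

lemma capped_is_matroid:
  fixes \<C> :: "('e::finite set \<times> nat) set"
  assumes dir: "tight_directed \<C>"
  shows "is_matroid (capped \<C>)"
  unfolding is_matroid_def
proof (intro conjI allI impI)
  show "indep (capped \<C>) {}" by (auto simp: indep_capped)
  fix X Y :: "'e set"
  assume XY: "indep (capped \<C>) X \<and> indep (capped \<C>) Y \<and> card X < card Y"
  show "\<exists>y\<in>Y - X. indep (capped \<C>) (insert y X)"
  proof (rule ccontr)
    assume no: "\<not> ?thesis"
    show False
    proof (rule capped_saturated[OF dir, of X Y])
      assume "Y \<subseteq> X"
      then show False using XY card_mono[of X Y] by simp
    next
      fix T d assume T: "(T, d) \<in> \<C>" "card (X \<inter> T) = d" "Y \<subseteq> X \<union> T"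
      have "card Y = card (Y \<inter> T) + card (Y - T)" by (rule card_Int_Diff) simp
      moreover have "card X = card (X \<inter> T) + card (X - T)" by (rule card_Int_Diff) simp
      moreover have "card (Y \<inter> T) \<le> d" using XY T(1) by (auto simp: indep_capped)
      moreover have "card (Y - T) \<le> card (X - T)" using T(3) by (intro card_mono) auto
      ultimately show False using XY T(2) by simp
    qed (use XY no in auto)
  qed
qed (auto intro: capped_subset_indep)

lemma rank_of_capped_le:
  assumes "is_matroid (capped \<C>)" "(S, c) \<in> \<C>"
  shows "rank_of (capped \<C>) S \<le> c"
proof -
  obtain I where I: "indep (capped \<C>) I" "I \<subseteq> S" "card I = rank_of (capped \<C>) S"
    using rank_of_attained[OF assms(1)] .
  then have "card (I \<inter> S) \<le> c" using assms(2) by (auto simp: indep_capped)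
  then show ?thesis using I by (simp add: Int_absorb2)
qed

text \<open>
  A maximal independent set \<open>B\<close> is the whole space or covers everything outside some tight set, and
  in the second case \<open>co\<close> for that set gives \<open>B\<close> at least \<open>r\<close> elements.
\<close>

lemma capped_in_matroids_of_rank:
  fixes \<C> :: "('e::finite set \<times> nat) set"
  assumes dir: "tight_directed \<C>" and r: "(UNIV, r) \<in> \<C>" "r \<le> CARD('e)"
    and co: "\<And>S c. (S, c) \<in> \<C> \<Longrightarrow> r \<le> c + card (- S)"
  shows "capped \<C> \<in> matroids_of_rank r"
proof -
  let ?M = "capped \<C>"
  have M: "is_matroid ?M" by (rule capped_is_matroid[OF dir])
  obtain B where B: "indep ?M B" "card B = rank_of ?M UNIV"
    using rank_of_attained[OF M, of UNIV] by metis
  have "r \<le> card B"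
  proof (rule capped_saturated[OF dir B(1), of UNIV])
    fix y assume "y \<in> UNIV - B"
    then show "\<not> indep ?M (insert y B)"
      using card_le_rank_of[OF M, of "insert y B" UNIV] B(2) by auto
  next
    assume "UNIV \<subseteq> B"
    then show ?thesis using r(2) by (metis UNIV_I subsetI subset_antisym)
  next
    fix T d assume T: "(T, d) \<in> \<C>" "card (B \<inter> T) = d" "UNIV \<subseteq> B \<union> T"
    have "card B = card (B \<inter> T) + card (B - T)" by (rule card_Int_Diff) simp
    moreover have "card (- T) \<le> card (B - T)" using T(3) by (intro card_mono) auto
    ultimately show ?thesis using co[OF T(1)] T(2) by simp
  qed
  then have "rank_of ?M UNIV = r" using rank_of_capped_le[OF M r(1)] B(2) by simp
  then show ?thesis using M by (simp add: matroids_of_rank_def)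
qed

text \<open>
  By Edmonds' description it suffices that the bounds imply \<open>x(S) \<le> r(S)\<close> for every set \<open>S\<close>. For a
  maximal independent subset \<open>I\<close> of \<open>S\<close>, \<open>I = S\<close> or some tight set \<open>T\<close> covers \<open>S - I\<close>; then
  \<open>x(S) \<le> x(T) + card (S - T) \<le> card (I \<inter> T) + card (I - T)\<close>.
\<close>

lemma matroid_polytope_capped:
  fixes \<C> :: "('e::finite set \<times> nat) set"
  assumes dir: "tight_directed \<C>" and r: "(UNIV, r) \<in> \<C>" "capped \<C> \<in> matroids_of_rank r"
  shows "matroid_polytope (capped \<C>) =
    {x. (\<forall>e. 0 \<le> x $ e \<and> x $ e \<le> 1) \<and> mass x UNIV = r \<and> (\<forall>(S, c)\<in>\<C>. mass x S \<le> c)}"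
    (is "_ = ?Q")
proof -
  let ?M = "capped \<C>"
  have M: "is_matroid ?M" by (rule capped_is_matroid[OF dir])
  have rk: "rank_of ?M UNIV = r" using r(2) by (simp add: matroids_of_rank_def)
  have inQ: "x \<in> ?Q" if x: "mass x UNIV = r" "\<And>S. mass x S \<le> rank_of ?M S" for x
  proof -
    have "x $ e \<le> 1" for e
      using x(2)[of "{e}"] rank_of_le_card[OF M, of "{e}"] by simp
    moreover have "0 \<le> x $ e" for e
    proof -
      have "mass x UNIV = x $ e + mass x (UNIV - {e})" by (rule sum.remove) auto
      moreover have "mass x (UNIV - {e}) \<le> r"
        using x(2)[of "UNIV - {e}"] rank_of_mono[OF M, of "UNIV - {e}" UNIV] rk by simp
      ultimately show ?thesis using x(1) by simp
    qed
    moreover have "mass x S \<le> c" if "(S, c) \<in> \<C>" for S c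
      using x(2)[of S] rank_of_capped_le[OF M that] by simp
    ultimately show ?thesis using x(1) by auto
  qed
  have le_rank: "mass x S \<le> rank_of ?M S" if x: "x \<in> ?Q" for x S
  proof -
    obtain I where I: "indep ?M I" "I \<subseteq> S" "card I = rank_of ?M S"
      using rank_of_attained[OF M] .
    have le_card: "mass x T \<le> card T" for T
      using sum_bounded_above[of T "($) x" 1] x by simp
    have "mass x S \<le> card I"
    proof (rule capped_saturated[OF dir I(1), of S])
      fix y assume y: "y \<in> S - I"
      then have "card (insert y I) = Suc (card I)" by simp
      then show "\<not> indep ?M (insert y I)"
        using card_le_rank_of[OF M, of "insert y I" S] y I by auto
    next
      assume "S \<subseteq> I"
      then show ?thesis using I(2) le_card[of S] by (simp add: subset_antisym)
    next
      fix T d assume T: "(T, d) \<in> \<C>" "card (I \<inter> T) = d" "S \<subseteq> I \<union> T"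
      have "mass x S \<le> mass x (T \<union> (S - T))"
        using x by (intro sum_mono2) auto
      also have "\<dots> = mass x T + mass x (S - T)"
        by (rule sum.union_disjoint) auto
      also have "\<dots> \<le> d + card (S - T)"
        using x T(1) le_card[of "S - T"] by auto
      also have "card (S - T) \<le> card (I - T)" using T(3) by (intro card_mono) auto
      also have "d + card (I - T) = card I"
        using card_Int_Diff[of I T] T(2) by simp
      finally show ?thesis by simp
    qed
    then show ?thesis using I(3) by simp
  qed
  show ?thesis
    unfolding matroid_polytope_eq[OF r(2)]
  proof (intro equalityI subsetI)
    fix x assume "x \<in> {x. mass x UNIV = r \<and> (\<forall>S. mass x S \<le> rank_of ?M S)}"
    then have "mass x UNIV = r" "\<And>S. mass x S \<le> rank_of ?M S" by simp_all
    then show "x \<in> ?Q" by (rule inQ)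
  next
    fix x assume x: "x \<in> ?Q"
    then have "mass x UNIV = r" by simp
    then show "x \<in> {x. mass x UNIV = r \<and> (\<forall>S. mass x S \<le> rank_of ?M S)}"
      using le_rank[OF x] by simp
  qed
qed

definition caps_chain :: "('e set \<times> nat) set \<Rightarrow> bool" where
  "caps_chain \<C> \<longleftrightarrow> (\<forall>(S, c)\<in>\<C>. \<forall>(T, d)\<in>\<C>. S \<subseteq> T \<or> T \<subseteq> S)"

lemma caps_chainD:
  "caps_chain \<C> \<Longrightarrow> (S, c) \<in> \<C> \<Longrightarrow> (T, d) \<in> \<C> \<Longrightarrow> S \<subseteq> T \<or> T \<subseteq> S"
  unfolding caps_chain_def by blast

lemma caps_chain_subset: "caps_chain \<D> \<Longrightarrow> \<C> \<subseteq> \<D> \<Longrightarrow> caps_chain \<C>"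
  unfolding caps_chain_def by blast

lemma tight_directedI:
  assumes "\<And>X S T. indep (capped \<C>) X \<Longrightarrow> (S, card (X \<inter> S)) \<in> \<C> \<Longrightarrow> (T, card (X \<inter> T)) \<in> \<C> \<Longrightarrow>
    \<exists>U. (U, card (X \<inter> U)) \<in> \<C> \<and> S \<subseteq> U \<and> T \<subseteq> U"
  shows "tight_directed \<C>"
  unfolding tight_directed_def
proof (intro allI impI ballI, clarify)
  fix X S T
  assume "indep (capped \<C>) X" "(S, card (X \<inter> S)) \<in> \<C>" "(T, card (X \<inter> T)) \<in> \<C>"
  from assms[OF this] obtain U where "(U, card (X \<inter> U)) \<in> \<C>" "S \<subseteq> U" "T \<subseteq> U" by blast
  then show "\<exists>(U, u)\<in>\<C>. card (X \<inter> U) = u \<and> S \<subseteq> U \<and> T \<subseteq> U"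
    by (intro bexI[of _ "(U, card (X \<inter> U))"]) auto
qed

lemma chain_tight_directed:
  assumes "caps_chain \<C>"
  shows "tight_directed \<C>"
proof (rule tight_directedI)
  fix X S T
  assume ST: "(S, card (X \<inter> S)) \<in> \<C>" "(T, card (X \<inter> T)) \<in> \<C>"
  then show "\<exists>U. (U, card (X \<inter> U)) \<in> \<C> \<and> S \<subseteq> U \<and> T \<subseteq> U"
    using caps_chainD[OF assms ST] by blast
qed

lemma circuit_capped:
  fixes C :: "'e::finite set"
  assumes C: "circuit (capped \<C>) C"
  obtains S c where "(S, c) \<in> \<C>" "C \<subseteq> S" "card C = Suc c"
proof -
  have "\<not> indep (capped \<C>) C" using C unfolding circuit_def by blast
  then obtain S c where S: "(S, c) \<in> \<C>" "c < card (C \<inter> S)"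
    by (auto simp: indep_capped not_le)
  then have "\<not> indep (capped \<C>) (C \<inter> S)"
    by (force simp: indep_capped not_le)
  then have CS: "C \<inter> S = C"
    using C unfolding circuit_def by (metis Int_lower1 psubsetI)
  then obtain x where x: "x \<in> C" using S(2) by fastforce
  then have "card ((C - {x}) \<inter> S) \<le> c"
    using circuit_remove_indep[OF C x] S(1) by (auto simp: indep_capped)
  moreover have "(C - {x}) \<inter> S = C - {x}" using CS by blast
  ultimately have "card C = Suc c"
    using S(2) CS x by simp
  then show ?thesis using that S(1) CS by blast
qed

text \<open>
  A nonempty cyclic flat contains a circuit that lies in some set \<open>S\<close> of the chain and exceeds its
  bound by one. Taking \<open>S\<close> as large as possible, the flat lies inside \<open>S\<close> and has the rank of \<open>S\<close>,
  so it equals \<open>S\<close>. Thus the nonempty cyclic flats belong to the chain.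
\<close>

lemma chain_capped_nested:
  fixes \<C> :: "('e::finite set \<times> nat) set"
  assumes ch: "caps_chain \<C>"
  shows "nested (capped \<C>)"
proof -
  let ?M = "capped \<C>"
  have M: "is_matroid ?M"
    by (intro capped_is_matroid chain_tight_directed ch)
  have "F \<in> insert {} (fst ` \<C>)" if F: "cyclic_flat ?M F" for F
  proof (cases "F = {}")
    case False
    obtain \<D> where \<D>: "\<D> \<subseteq> {C. circuit ?M C}" "F = \<Union>\<D>"
      using F by (auto simp: cyclic_flat_def)
    define \<S> where "\<S> = {S. \<exists>c C. (S, c) \<in> \<C> \<and> C \<in> \<D> \<and> C \<subseteq> S \<and> card C = Suc c}"
    have cov: "\<exists>S\<in>\<S>. C \<subseteq> S" if "C \<in> \<D>" for C
    proof -
      have "circuit ?M C" using \<D>(1) that by blast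
      then obtain S c where "(S, c) \<in> \<C>" "C \<subseteq> S" "card C = Suc c"
        by (rule circuit_capped)
      then show ?thesis using that unfolding \<S>_def by blast
    qed
    then have "\<S> \<noteq> {}" using False \<D>(2) by blast
    then obtain S where S: "S \<in> \<S>" "\<And>T. T \<in> \<S> \<Longrightarrow> S \<subseteq> T \<Longrightarrow> S = T"
      using finite_has_maximal[of \<S>] by auto
    have "T \<subseteq> S" if "T \<in> \<S>" for T
    proof -
      obtain c where "(S, c) \<in> \<C>" using S(1) unfolding \<S>_def by blast
      moreover obtain d where "(T, d) \<in> \<C>" using \<open>T \<in> \<S>\<close> unfolding \<S>_def by blast
      ultimately show ?thesis using caps_chainD[OF ch] S(2)[OF that] by blast
    qed
    then have FS: "F \<subseteq> S" using cov \<D>(2) by blast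
    obtain c C where C: "(S, c) \<in> \<C>" "C \<in> \<D>" "C \<subseteq> S" "card C = Suc c"
      using S(1) by (auto simp: \<S>_def)
    have "C \<noteq> {}" using C(4) by auto
    then obtain x where x: "x \<in> C" by blast
    have "C - {x} \<subseteq> F" using C(2) \<D>(2) by blast
    moreover have "indep ?M (C - {x})"
      using circuit_remove_indep[OF _ x] \<D>(1) C(2) by blast
    ultimately have "card (C - {x}) \<le> rank_of ?M F"
      using card_le_rank_of[OF M] by blast
    then have rF: "c \<le> rank_of ?M F" using C(4) x by simp
    have "S \<subseteq> F"
    proof
      fix y assume "y \<in> S"
      show "y \<in> F"
      proof (rule ccontr)
        assume "y \<notin> F"
        then have "rank_of ?M F < rank_of ?M (insert y F)"
          using F by (auto simp: cyclic_flat_def flat_def)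
        also have "\<dots> \<le> rank_of ?M S"
          using FS \<open>y \<in> S\<close> by (intro rank_of_mono[OF M]) auto
        also have "\<dots> \<le> c" by (rule rank_of_capped_le[OF M C(1)])
        finally show False using rF by simp
      qed
    qed
    then show ?thesis using FS C(1) by force
  qed simp
  then have cf: "F = {} \<or> (\<exists>c. (F, c) \<in> \<C>)" if "cyclic_flat ?M F" for F
    using that by force
  show ?thesis
    unfolding nested_def
  proof (intro allI impI, elim conjE)
    fix F G assume "cyclic_flat ?M F" "cyclic_flat ?M G"
    then show "F \<subseteq> G \<or> G \<subseteq> F"
      using cf[of F] cf[of G] caps_chainD[OF ch] by blast
  qed
qed

section \<open>Relabelling the ground set\<close>

text \<open>
  For a bijection \<open>f\<close> this is the image of \<open>M\<close> under \<open>f\<close>. The independent sets are written with the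
  preimage, so that relabellings by arbitrary functions compose.
\<close>

definition relabel :: "('e \<Rightarrow> 'e) \<Rightarrow> 'e::finite matroid \<Rightarrow> 'e matroid" where
  "relabel f M = \<lparr>ground = UNIV, indep = (\<lambda>X. indep M (f -` X))\<rparr>"

lemma ground_relabel [simp]: "ground (relabel f M) = UNIV"
  and indep_relabel [simp]: "indep (relabel f M) X \<longleftrightarrow> indep M (f -` X)"
  by (simp_all add: relabel_def)

lemma relabel_relabel: "relabel g (relabel f M) = relabel (g \<circ> f) M"
  by (simp add: relabel_def vimage_comp)

lemma relabel_id: "ground M = UNIV \<Longrightarrow> relabel id M = M"
  by (simp add: relabel_def)

lemma card_vimage_permutes: "f permutes UNIV \<Longrightarrow> card (f -` X) = card X"
  by (rule card_vimage_inj) (auto simp: permutes_inj permutes_surj)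

lemma relabel_in_matroids_of_rank:
  fixes M :: "'e::finite matroid"
  assumes f: "f permutes UNIV" and "M \<in> matroids_of_rank r"
  shows "relabel f M \<in> matroids_of_rank r"
proof -
  have M: "is_matroid M" "ground M = UNIV" "matroid_rank M = r"
    using assms(2) by (auto simp: matroids_of_rank_def)
  have "is_matroid (relabel f M)"
    unfolding is_matroid_def
  proof (intro conjI allI impI)
    fix X Y assume "indep (relabel f M) Y \<and> X \<subseteq> Y"
    then show "indep (relabel f M) X"
      using indep_subset[OF M(1), of "f -` Y" "f -` X"] by (simp add: vimage_mono)
  next
    fix X Y :: "'e set"
    assume XY: "indep (relabel f M) X \<and> indep (relabel f M) Y \<and> card X < card Y"
    then obtain y where y: "y \<in> f -` Y - f -` X" "indep M (insert y (f -` X))"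
      using indep_exchange[OF M(1), of "f -` X" "f -` Y"] card_vimage_permutes[OF f] by auto
    have "f -` insert (f y) X = insert y (f -` X)"
      using permutes_inj[OF f] by (auto dest: injD)
    then show "\<exists>y\<in>Y - X. indep (relabel f M) (insert y X)"
      using y by (intro bexI[of _ "f y"]) auto
  qed (use indep_empty[OF M(1)] in auto)
  moreover have "rank_of (relabel f M) UNIV = rank_of M UNIV"
  proof -
    have "card ` {I. indep M (f -` I)} = card ` {I. indep M I}"
    proof (intro equalityI subsetI)
      fix k assume "k \<in> card ` {I. indep M (f -` I)}"
      then show "k \<in> card ` {I. indep M I}"
        using card_vimage_permutes[OF f] by (metis (mono_tags, lifting) imageE image_eqI mem_Collect_eq)
    next
      fix k assume "k \<in> card ` {I. indep M I}"
      then obtain I where I: "k = card I" "indep M I" by auto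
      have "f -` (f ` I) = I" using permutes_inj[OF f] by (rule inj_vimage_image_eq)
      moreover have "card (f ` I) = k"
        using I(1) permutes_inj_on[OF f] by (simp add: card_image)
      ultimately show "k \<in> card ` {I. indep M (f -` I)}"
        using I by (intro image_eqI[of _ _ "f ` I"]) auto
    qed
    then show ?thesis by (simp add: rank_of_def)
  qed
  ultimately show ?thesis using M by (simp add: matroids_of_rank_def)
qed

lemma matroid_polytope_relabel:
  fixes M :: "'e::finite matroid"
  assumes f: "f permutes UNIV" and M: "M \<in> matroids_of_rank r"
  shows "x \<in> matroid_polytope (relabel f M) \<longleftrightarrow> (\<chi> e. x $ f e) \<in> matroid_polytope M"
proof -
  define p :: "real ^ 'e \<Rightarrow> real ^ 'e" where "p x = (\<chi> e. x $ f e)" for x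
  have lin: "linear p" by (rule linearI) (simp_all add: p_def vec_eq_iff)
  have inj: "inj p"
  proof (rule injI)
    fix x y assume "p x = p y"
    then have "x $ f e = y $ f e" for e by (simp add: p_def vec_eq_iff)
    then have "x $ e = y $ e" for e using permutes_surj[OF f] by (metis surjD)
    then show "x = y" by (simp add: vec_eq_iff)
  qed
  have char: "p (char_vec B) = char_vec (f -` B)" for B
    by (simp add: p_def char_vec_def vec_eq_iff indicator_def)
  have mat: "is_matroid (relabel f M)" "is_matroid M" "matroid_rank (relabel f M) = matroid_rank M"
    using M relabel_in_matroids_of_rank[OF f M] by (auto simp: matroids_of_rank_def)
  have basis: "is_basis (relabel f M) B \<longleftrightarrow> is_basis M (f -` B)" for B
    using mat card_vimage_permutes[OF f]
    by (simp add: is_basis_iff_card[OF mat(1)] is_basis_iff_card[OF mat(2)])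
  have "p ` char_vec ` {B. is_basis (relabel f M) B} = char_vec ` {B. is_basis M B}"
  proof (intro equalityI subsetI)
    fix v assume "v \<in> char_vec ` {B. is_basis M B}"
    then obtain B where B: "is_basis M B" "v = char_vec B" by auto
    have "f -` (f ` B) = B" using permutes_inj[OF f] by (rule inj_vimage_image_eq)
    then have "is_basis (relabel f M) (f ` B)" "v = p (char_vec (f ` B))"
      using B basis char by simp_all
    then show "v \<in> p ` char_vec ` {B. is_basis (relabel f M) B}" by blast
  qed (auto simp: char basis)
  then have "p ` matroid_polytope (relabel f M) = matroid_polytope M"
    unfolding matroid_polytope_def by (simp add: convex_hull_linear_image[OF lin])
  then have "x \<in> matroid_polytope (relabel f M) \<longleftrightarrow> p x \<in> matroid_polytope M"
    using inj_image_mem_iff[OF inj] by blast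
  then show ?thesis by (simp add: p_def)
qed

text \<open>
  Permuting the coordinates of the argument amounts to relabelling the matroid, so the symmetrized
  indicator is an average of ordinary indicators of matroid polytopes.
\<close>

lemma sym_indicator_matroid_polytope:
  fixes M :: "'e::finite matroid"
  assumes "M \<in> matroids_of_rank r"
  shows "sym_indicator (matroid_polytope M) x =
    (\<Sum>f | f permutes UNIV. indicator (matroid_polytope (relabel f M)) x) / fact CARD('e)"
  unfolding sym_indicator_def
  using matroid_polytope_relabel[OF _ assms] by (simp add: indicator_def)

lemma sym_indicator_relabel:
  fixes M :: "'e::finite matroid"
  assumes f: "f permutes UNIV" and M: "M \<in> matroids_of_rank r"
  shows "sym_indicator (matroid_polytope (relabel f M)) = sym_indicator (matroid_polytope M)"
proof
  fix x
  show "sym_indicator (matroid_polytope (relabel f M)) x = sym_indicator (matroid_polytope M) x"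
    using sum_permutations_compose_right[OF f, of "\<lambda>g. indicator (matroid_polytope (relabel g M)) x :: real"]
    by (simp add: sym_indicator_matroid_polytope[OF M] relabel_relabel
        sym_indicator_matroid_polytope[OF relabel_in_matroids_of_rank[OF f M]])
qed

lemma matroid_iso_relabel:
  fixes M :: "'e::finite matroid"
  assumes "f permutes UNIV" "ground M = UNIV"
  shows "matroid_iso M (relabel f M)"
  unfolding matroid_iso_def using assms
  by (intro exI[of _ f]) (auto simp: permutes_bij inj_vimage_image_eq permutes_inj)

lemma matroid_iso_obtain_relabel:
  fixes M N :: "'e::finite matroid"
  assumes "matroid_iso M N" "ground M = UNIV" "ground N = UNIV"
  obtains f where "f permutes UNIV" "N = relabel f M"
proof -
  obtain f where f: "bij f" "\<And>X. indep M X \<longleftrightarrow> indep N (f ` X)"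
    using assms by (auto simp: matroid_iso_def)
  have "indep N Y \<longleftrightarrow> indep M (f -` Y)" for Y
    using f(2)[of "f -` Y"] bij_is_surj[OF f(1)] by (simp add: surj_image_vimage_eq)
  then have "N = relabel f M"
    by (intro matroid.equality) (auto simp: assms)
  moreover have "f permutes UNIV" using f(1) by (auto intro: bij_imp_permutes)
  ultimately show ?thesis using that by blast
qed

section \<open>Linear independence of the nested matroids\<close>

text \<open>
  The polytope of a matroid meets the region \<open>{x. \<forall>F\<in>\<C>. x(F) \<ge> s F}\<close> if and only if the ranks of the
  members of \<open>\<C>\<close> are at least \<open>s\<close>: a flag basis supplies the point. So the Euler characteristic
  yields the relation with \<open>\<ge>\<close> in place of equality, for all \<open>s\<close>. Subtracting the relation for
  \<open>s F + 1\<close> from the one for \<open>s F\<close> turns \<open>\<ge>\<close> into equality, one member \<open>F\<close> at a time.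
\<close>

lemma chain_rank_sum_zero:
  fixes M :: "'i \<Rightarrow> 'e::finite matroid" and c :: "'i \<Rightarrow> real"
  assumes I: "finite I" and M: "\<And>i. i \<in> I \<Longrightarrow> M i \<in> matroids_of_rank r"
    and zero: "\<And>x. (\<Sum>i\<in>{i\<in>I. x \<in> matroid_polytope (M i)}. c i) = 0"
    and chain: "\<And>F G. F \<in> \<C> \<Longrightarrow> G \<in> \<C> \<Longrightarrow> F \<subseteq> G \<or> G \<subseteq> F"
  shows "(\<Sum>i\<in>{i\<in>I. \<forall>F\<in>\<C>. rank_of (M i) F = s F}. c i) = 0"
proof -
  have ge: "(\<Sum>i\<in>{i\<in>I. \<forall>F\<in>\<C>. s F \<le> rank_of (M i) F}. c i) = 0" for s
  proof -
    define H where "H = (\<Inter>F\<in>\<C>. (\<lambda>x. mass x F) -` {real (s F)..})"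
    have H: "closed H" "convex H"
      unfolding H_def
      by (auto intro!: closed_INT continuous_closed_vimage convex_INT convex_linear_vimage linear_mass
          continuous_intros)
    have "matroid_polytope (M i) \<inter> H \<noteq> {} \<longleftrightarrow> (\<forall>F\<in>\<C>. s F \<le> rank_of (M i) F)" if "i \<in> I" for i
    proof
      assume "matroid_polytope (M i) \<inter> H \<noteq> {}"
      then obtain x where x: "x \<in> matroid_polytope (M i)" "x \<in> H" by blast
      then have "mass x F \<le> rank_of (M i) F" for F
        using matroid_polytope_eq[OF M[OF that]] by blast
      moreover have "s F \<le> mass x F" if "F \<in> \<C>" for F
        using x(2) that by (auto simp: H_def)
      ultimately show "\<forall>F\<in>\<C>. s F \<le> rank_of (M i) F"
        using order_trans of_nat_le_iff by meson
    next
      assume s: "\<forall>F\<in>\<C>. s F \<le> rank_of (M i) F"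
      have Mi: "is_matroid (M i)" "ground (M i) = UNIV"
        using M[OF that] by (auto simp: matroids_of_rank_def)
      have "\<exists>B. indep (M i) B \<and> B \<subseteq> \<Union>(insert UNIV \<C>) \<and>
          (\<forall>F\<in>insert UNIV \<C>. card (B \<inter> F) = rank_of (M i) F)"
        by (rule flag_basis[OF Mi(1)]) (use chain in auto)
      then obtain B where B: "indep (M i) B" "\<And>F. F \<in> insert UNIV \<C> \<Longrightarrow> card (B \<inter> F) = rank_of (M i) F"
        by blast
      have "is_basis (M i) B"
        using B(1) B(2)[of UNIV] Mi by (simp add: is_basis_iff_card[OF Mi(1)])
      then have "char_vec B \<in> matroid_polytope (M i)"
        by (auto simp: matroid_polytope_def intro: hull_inc)
      moreover have "char_vec B \<in> H"
        using s B(2) by (auto simp: H_def mass_char_vec)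
      ultimately show "matroid_polytope (M i) \<inter> H \<noteq> {}" by blast
    qed
    then have "{i\<in>I. \<forall>F\<in>\<C>. s F \<le> rank_of (M i) F} = {i\<in>I. matroid_polytope (M i) \<inter> H \<noteq> {}}"
      by auto
    moreover have "(\<Sum>i\<in>{i\<in>I. matroid_polytope (M i) \<inter> H \<noteq> {}}. c i) = 0"
    proof (rule sum_coefficients_nonempty_zero[OF I])
      fix x
      show "(\<Sum>i\<in>{i\<in>I. x \<in> matroid_polytope (M i) \<inter> H}. c i) = 0"
        using zero[of x] by (cases "x \<in> H") auto
    qed (use H in \<open>auto simp: matroid_polytope_def intro!: compact_Int_closed convex_Int
          finite_imp_compact_convex_hull\<close>)
    ultimately show ?thesis by simp
  qed
  have "(\<Sum>i\<in>{i\<in>I. (\<forall>F\<in>\<T>. rank_of (M i) F = s F) \<and> (\<forall>F\<in>\<C> - \<T>. s F \<le> rank_of (M i) F)}. c i) = 0"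
    if "finite \<T>" "\<T> \<subseteq> \<C>" for \<T> s
    using that
  proof (induction \<T> arbitrary: s rule: finite_induct)
    case empty
    then show ?case using ge[of s] by simp
  next
    case (insert G \<T>)
    let ?A = "\<lambda>\<T> s. {i\<in>I. (\<forall>F\<in>\<T>. rank_of (M i) F = s F) \<and> (\<forall>F\<in>\<C> - \<T>. s F \<le> rank_of (M i) F)}"
    \<comment> \<open>\<open>rank G \<ge> s G\<close> splits into \<open>rank G = s G\<close> and \<open>rank G \<ge> s G + 1\<close>.\<close>
    define t where "t = s(G := Suc (s G))"
    have tG: "t G = Suc (s G)" and t: "\<And>F. F \<noteq> G \<Longrightarrow> t F = s F" by (simp_all add: t_def)
    have G: "G \<in> \<C>" "G \<notin> \<T>" using insert by auto
    have mem: "i \<in> ?A \<T> u \<longleftrightarrow> i \<in> I \<and> (\<forall>F\<in>\<T>. rank_of (M i) F = u F) \<and>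
        (\<forall>F\<in>\<C> - insert G \<T>. u F \<le> rank_of (M i) F) \<and> u G \<le> rank_of (M i) G" for i u
      using G by auto
    have tT: "(\<forall>F\<in>\<T>. rank_of (M i) F = t F) \<longleftrightarrow> (\<forall>F\<in>\<T>. rank_of (M i) F = s F)" for i
      by (intro ball_cong refl) (metis t G(2))
    have tC: "(\<forall>F\<in>\<C> - insert G \<T>. t F \<le> rank_of (M i) F) \<longleftrightarrow> (\<forall>F\<in>\<C> - insert G \<T>. s F \<le> rank_of (M i) F)" for i
      by (intro ball_cong refl) (metis t Diff_iff insertI1)
    have "?A \<T> s = ?A (insert G \<T>) s \<union> ?A \<T> t"
    proof (rule set_eqI)
      fix i
      show "i \<in> ?A \<T> s \<longleftrightarrow> i \<in> ?A (insert G \<T>) s \<union> ?A \<T> t"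
        by (simp only: Un_iff mem, simp only: tT tC tG) (auto simp: Suc_le_eq)
    qed
    moreover have "?A (insert G \<T>) s \<inter> ?A \<T> t = {}"
    proof -
      have "i \<notin> ?A \<T> t" if "i \<in> ?A (insert G \<T>) s" for i
        unfolding mem tG using that by simp
      then show ?thesis by blast
    qed
    ultimately have "sum c (?A \<T> s) = sum c (?A (insert G \<T>) s) + sum c (?A \<T> t)"
      using I by (simp add: sum.union_disjoint)
    then show ?case using insert.IH[of s] insert.IH[of t] insert.prems by simp
  qed
  from this[of \<C> s] show ?thesis by simp
qed

text \<open>
  Among the matroids with nonzero coefficient take one, \<open>N m\<close>, with the fewest independent sets. The
  cyclic flats of \<open>N m\<close> form a chain. A labelled matroid with the same ranks on them
  has no other independent sets than those of \<open>N m\<close>, hence equals \<open>N m\<close> by minimality. So in the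
  relation selected by these ranks only copies of \<open>N m\<close> occur.
\<close>

lemma nested_sym_indicators_independent:
  fixes N :: "'k::finite \<Rightarrow> 'e::finite matroid"
  assumes N: "nested_enumeration r N"
    and zero: "\<And>x. (\<Sum>j\<in>UNIV. w j * sym_indicator (matroid_polytope (N j)) x) = 0"
  shows "w k = 0"
proof (rule ccontr)
  assume "w k \<noteq> 0"
  let ?P = "{f. f permutes (UNIV :: 'e set)}"
  define n where "n j = card {X. indep (N j) X}" for j
  obtain m where m: "w m \<noteq> 0" "\<And>j. w j \<noteq> 0 \<Longrightarrow> n m \<le> n j"
    using arg_min_natI[of "\<lambda>j. w j \<noteq> 0" k n] arg_min_nat_le[of "\<lambda>j. w j \<noteq> 0" _ n]
      \<open>w k \<noteq> 0\<close> by blast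
  have Nr: "N j \<in> matroids_of_rank r" "nested (N j)" for j
    using N unfolding nested_enumeration_def by blast+
  have Nm: "is_matroid (N j)" "ground (N j) = UNIV" for j
    using Nr(1)[of j] by (auto simp: matroids_of_rank_def)
  define R where "R i = relabel (snd i) (N (fst i))" for i
  define \<C> where "\<C> = {F. cyclic_flat (N m) F}"
  define A where "A = {i \<in> (UNIV :: 'k set) \<times> ?P. \<forall>F\<in>\<C>. rank_of (R i) F = rank_of (N m) F}"
  have finP: "finite ?P" by (rule finite_permutations) simp
  have "(\<Sum>i\<in>A. w (fst i)) = 0"
    unfolding A_def
  proof (rule chain_rank_sum_zero)
    show "finite ((UNIV :: 'k set) \<times> ?P)" using finP by simp
    fix i assume "i \<in> (UNIV :: 'k set) \<times> ?P"
    then show "R i \<in> matroids_of_rank r"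
      using relabel_in_matroids_of_rank[OF _ Nr(1)] by (auto simp: R_def)
  next
    fix x
    have "(\<Sum>i\<in>{i \<in> (UNIV :: 'k set) \<times> ?P. x \<in> matroid_polytope (R i)}. w (fst i))
        = (\<Sum>i\<in>(UNIV :: 'k set) \<times> ?P. w (fst i) * indicator (matroid_polytope (R i)) x)"
      using finP by (intro sum.mono_neutral_cong_left) auto
    also have "\<dots> = (\<Sum>j\<in>UNIV. \<Sum>f\<in>?P. w j * indicator (matroid_polytope (relabel f (N j))) x)"
      unfolding sum.cartesian_product by (rule sum.cong) (auto simp: R_def)
    also have "\<dots> = fact CARD('e) * (\<Sum>j\<in>UNIV. w j * sym_indicator (matroid_polytope (N j)) x)"
      by (simp add: sym_indicator_matroid_polytope[OF Nr(1)] sum_distrib_left mult.left_commute)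
    finally show "(\<Sum>i\<in>{i \<in> (UNIV :: 'k set) \<times> ?P. x \<in> matroid_polytope (R i)}. w (fst i)) = 0"
      using zero by simp
  next
    fix F G assume "F \<in> \<C>" "G \<in> \<C>"
    then show "F \<subseteq> G \<or> G \<subseteq> F" using Nr(2)[of m] by (auto simp: \<C>_def nested_def)
  qed
  moreover have "w (fst i) = (if fst i = m then w m else 0)" if "i \<in> A" for i
  proof (cases "w (fst i) = 0")
    case True
    then show ?thesis using m(1) by auto
  next
    case False
    define j f where "j = fst i" and "f = snd i"
    have f: "f permutes UNIV" and rk: "\<And>F. cyclic_flat (N m) F \<Longrightarrow> rank_of (R i) F = rank_of (N m) F"
      using that by (auto simp: A_def \<C>_def f_def)
    have R: "R i = relabel f (N j)" by (simp add: R_def j_def f_def)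
    have mat: "is_matroid (R i)"
      using relabel_in_matroids_of_rank[OF f Nr(1)] R by (simp add: matroids_of_rank_def)
    have sub: "{X. indep (R i) X} \<subseteq> {X. indep (N m) X}"
    proof clarify
      fix X assume X: "indep (R i) X"
      show "indep (N m) X"
      proof (rule indep_if_cyclic_flat_bounds[OF Nm(1)])
        fix F assume "cyclic_flat (N m) F"
        then show "card (X \<inter> F) \<le> rank_of (N m) F"
          using card_le_rank_of[OF mat indep_subset[OF mat X], of "X \<inter> F" F] rk by simp
      qed (simp add: Nm(2))
    qed
    have "bij_betw ((-`) f) {X. indep (R i) X} {X. indep (N j) X}"
    proof (rule bij_betwI[where g = "(`) f"])
      show "f ` f -` X = X" for X using permutes_surj[OF f] by (rule surj_image_vimage_eq)
      show "f -` f ` X = X" for X using permutes_inj[OF f] by (rule inj_vimage_image_eq)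
    qed (auto simp: R inj_vimage_image_eq[OF permutes_inj[OF f]])
    then have "card {X. indep (R i) X} = n j"
      by (simp add: bij_betw_same_card n_def)
    then have "{X. indep (R i) X} = {X. indep (N m) X}"
      using sub m(2)[of j] False by (intro card_seteq) (auto simp: n_def j_def)
    then have "N m = R i"
      by (intro matroid.equality) (auto simp: Nm(2) R set_eq_iff fun_eq_iff)
    then have "matroid_iso (N j) (N m)"
      using matroid_iso_relabel[OF f Nm(2)] R by simp
    moreover have "matroid_iso (N j) (N j)"
      using matroid_iso_relabel[OF permutes_id Nm(2)] relabel_id[OF Nm(2)] by metis
    ultimately have "j = m"
      using N Nr by (auto simp: nested_enumeration_def)
    then show ?thesis by (simp add: j_def)
  qed
  ultimately have "(\<Sum>i\<in>A. if fst i = m then w m else 0) = 0" by simp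
  moreover have "finite A" using finP by (simp add: A_def)
  ultimately have "card {i\<in>A. fst i = m} * w m = 0"
    by (simp add: sum.If_cases Int_def)
  moreover have "(m, id) \<in> {i\<in>A. fst i = m}"
    by (simp add: A_def R_def relabel_id[OF Nm(2)] permutes_id)
  ultimately show False using m(1) \<open>finite A\<close> by auto
qed

section \<open>Iterated free products of uniform matroids\<close>

lemma rank_of_uniform:
  fixes E :: "'a::finite set"
  assumes "J \<subseteq> E"
  shows "rank_of (uniform_matroid r E) J = min (card J) r"
  unfolding rank_of_def
proof (rule Max_eqI)
  obtain I where "I \<subseteq> J" "card I = min (card J) r"
    using obtain_subset_with_card_n[of "min (card J) r" J] by auto
  then show "min (card J) r \<in> card ` {I. indep (uniform_matroid r E) I \<and> I \<subseteq> J}"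
    using assms by (intro image_eqI[of _ _ I]) (auto simp: uniform_matroid_def)
qed (auto simp: uniform_matroid_def card_mono)

text \<open>
  Choose \<open>t j\<close> elements from each \<open>E j\<close>.
\<close>

lemma partial_union_transversal:
  fixes E :: "nat \<Rightarrow> 'a::finite set"
  assumes disj: "disjoint_family_on E {1..n}" and t: "\<And>j. j \<in> {1..n} \<Longrightarrow> t j \<le> card (E j)"
  obtains X where "X \<subseteq> (\<Union>j\<in>{1..n}. E j)"
    "\<And>k. k \<le> n \<Longrightarrow> card (X \<inter> (\<Union>j\<in>{1..k}. E j)) = sum t {1..k}"
proof -
  have "\<forall>j\<in>{1..n}. \<exists>T. T \<subseteq> E j \<and> card T = t j"
    using t by (metis obtain_subset_with_card_n)
  then obtain T where T: "\<And>j. j \<in> {1..n} \<Longrightarrow> T j \<subseteq> E j" "\<And>j. j \<in> {1..n} \<Longrightarrow> card (T j) = t j"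
    by metis
  have E_disjoint: "E j \<inter> E l = {}" if "j \<in> {1..n}" "l \<in> {1..n}" "j \<noteq> l" for j l
    using disj that by (auto simp: disjoint_family_on_def)
  have "card ((\<Union>j\<in>{1..n}. T j) \<inter> (\<Union>j\<in>{1..k}. E j)) = sum t {1..k}" if k: "k \<le> n" for k
  proof -
    have "(\<Union>j\<in>{1..n}. T j) \<inter> (\<Union>j\<in>{1..k}. E j) = (\<Union>j\<in>{1..k}. T j)"
    proof (intro equalityI subsetI)
      fix x assume "x \<in> (\<Union>j\<in>{1..n}. T j) \<inter> (\<Union>j\<in>{1..k}. E j)"
      then obtain j l where jl: "j \<in> {1..n}" "x \<in> T j" "l \<in> {1..k}" "x \<in> E l" by auto
      then have "j = l" using E_disjoint[of j l] T(1)[of j] k by fastforce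
      then show "x \<in> (\<Union>j\<in>{1..k}. T j)" using jl by blast
    next
      fix x assume "x \<in> (\<Union>j\<in>{1..k}. T j)"
      then obtain j where j: "j \<in> {1..k}" "x \<in> T j" by auto
      then have "j \<in> {1..n}" using k by auto
      then show "x \<in> (\<Union>j\<in>{1..n}. T j) \<inter> (\<Union>j\<in>{1..k}. E j)"
        using j T(1)[of j] by blast
    qed
    also have "card \<dots> = (\<Sum>j\<in>{1..k}. card (T j))"
    proof (rule card_UN_disjoint)
      show "\<forall>j\<in>{1..k}. \<forall>l\<in>{1..k}. j \<noteq> l \<longrightarrow> T j \<inter> T l = {}"
      proof (intro ballI impI)
        fix j l assume "j \<in> {1..k}" "l \<in> {1..k}" "j \<noteq> l"
        then show "T j \<inter> T l = {}"
          using E_disjoint[of j l] T(1)[of j] T(1)[of l] k by fastforce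
      qed
    qed auto
    also have "\<dots> = sum t {1..k}" using T(2) k by (intro sum.cong) auto
    finally show ?thesis .
  qed
  moreover have "(\<Union>j\<in>{1..n}. T j) \<subseteq> (\<Union>j\<in>{1..n}. E j)" using T(1) by blast
  ultimately show ?thesis using that by blast
qed

text \<open>
  Since the ground sets are disjoint, \<open>X\<close> splits uniquely into \<open>I\<close> and \<open>J\<close>. The rank of \<open>J\<close> is the
  minimum of \<open>card J\<close> and \<open>r\<close>; with \<open>card J\<close>, the inequality of the free product only repeats
  that \<open>card I\<close> is at most the rank of \<open>M\<close>.
\<close>

lemma indep_free_product_uniform:
  fixes M :: "'a::finite matroid"
  assumes ind: "\<And>X. indep M X \<Longrightarrow> X \<subseteq> ground M \<and> card X \<le> matroid_rank M"
    and disj: "ground M \<inter> E = {}"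
  shows "indep (M \<box> uniform_matroid r E) X \<longleftrightarrow>
    X \<subseteq> ground M \<union> E \<and> indep M (X \<inter> ground M) \<and> card X \<le> matroid_rank M + r"
proof
  assume "indep (M \<box> uniform_matroid r E) X"
  then obtain I J where IJ: "X = I \<union> J" "indep M I" "J \<subseteq> E"
      "card X \<le> matroid_rank M + rank_of (uniform_matroid r E) J"
    by (auto simp: free_product_def uniform_matroid_def)
  have "X \<inter> ground M = I" using IJ ind[OF IJ(2)] disj by blast
  then show "X \<subseteq> ground M \<union> E \<and> indep M (X \<inter> ground M) \<and> card X \<le> matroid_rank M + r"
    using IJ ind[OF IJ(2)] by (auto simp: rank_of_uniform)
next
  assume X: "X \<subseteq> ground M \<union> E \<and> indep M (X \<inter> ground M) \<and> card X \<le> matroid_rank M + r"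
  have "X = (X \<inter> ground M) \<union> (X \<inter> E)" using X by blast
  moreover have "card ((X \<inter> ground M) \<union> (X \<inter> E)) = card (X \<inter> ground M) + card (X \<inter> E)"
    using disj by (intro card_Un_disjoint) auto
  moreover have "card (X \<inter> ground M) \<le> matroid_rank M" using ind X by blast
  ultimately have "card X \<le> matroid_rank M + rank_of (uniform_matroid r E) (X \<inter> E)"
    using X by (simp add: rank_of_uniform min_def)
  then have "X = (X \<inter> ground M) \<union> (X \<inter> E) \<and> indep M (X \<inter> ground M) \<and> X \<inter> E \<subseteq> E \<and>
      card X \<le> matroid_rank M + rank_of (uniform_matroid r E) (X \<inter> E)"
    using X by blast
  then show "indep (M \<box> uniform_matroid r E) X"
    by (simp add: free_product_def uniform_matroid_def) blast
qed

lemma iterated_free_product: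
  fixes E :: "nat \<Rightarrow> 'a::finite set"
  assumes disj: "disjoint_family_on E {1..n}" and card: "\<And>j. j \<in> {1..n} \<Longrightarrow> a j \<le> card (E j)"
    and "1 \<le> m" "m \<le> n"
  defines "F \<equiv> \<lambda>k. \<Union>j\<in>{1..k}. E j"
  defines "P \<equiv> \<lambda>m. foldl (\<box>) (uniform_matroid (a 1) (E 1)) (map (\<lambda>j. uniform_matroid (a j) (E j)) [2..<m + 1])"
  shows "ground (P m) = F m \<and> matroid_rank (P m) = sum a {1..m} \<and>
    (\<forall>X. indep (P m) X \<longleftrightarrow> X \<subseteq> F m \<and> (\<forall>k\<in>{1..m}. card (X \<inter> F k) \<le> sum a {1..k}))"
  using \<open>1 \<le> m\<close> \<open>m \<le> n\<close>
proof (induction m rule: nat_induct_at_least)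
  case base
  then show ?case
    by (simp add: P_def F_def uniform_matroid_def Int_absorb2 cong: conj_cong)
       (use card[of 1] rank_of_uniform[of "E 1" "E 1" "a 1"] in \<open>simp add: uniform_matroid_def\<close>)
next
  case (Suc m)
  let ?E = "E (Suc m)" let ?a = "a (Suc m)"
  have IH: "ground (P m) = F m" "matroid_rank (P m) = sum a {1..m}"
    "\<And>X. indep (P m) X \<longleftrightarrow> X \<subseteq> F m \<and> (\<forall>k\<in>{1..m}. card (X \<inter> F k) \<le> sum a {1..k})"
    using Suc by auto
  have P: "P (Suc m) = P m \<box> uniform_matroid ?a ?E"
    using Suc.hyps by (simp add: P_def)
  have F: "F (Suc m) = F m \<union> ?E" by (auto simp: F_def atLeastAtMostSuc_conv)
  have FF: "F k \<subseteq> F m" if "k \<le> m" for k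
    unfolding F_def using that by (intro UN_mono) auto
  have "E j \<inter> ?E = {}" if "j \<in> {1..m}" for j
    using disj Suc.prems that unfolding disjoint_family_on_def by auto
  then have d: "F m \<inter> ?E = {}" unfolding F_def by blast
  have "card X \<le> matroid_rank (P m)" if "indep (P m) X" for X
    using that Suc.hyps unfolding IH(2) IH(3) by (metis atLeastAtMost_iff inf.absorb1 order_refl)
  then have ind: "indep (P (Suc m)) X \<longleftrightarrow>
      X \<subseteq> F m \<union> ?E \<and> indep (P m) (X \<inter> F m) \<and> card X \<le> sum a {1..m} + ?a" for X
    unfolding P using indep_free_product_uniform[of "P m" ?E ?a X] IH d by auto
  have char: "indep (P (Suc m)) X \<longleftrightarrow>
      X \<subseteq> F (Suc m) \<and> (\<forall>k\<in>{1..Suc m}. card (X \<inter> F k) \<le> sum a {1..k})" for X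
  proof -
    have "X \<inter> F m \<inter> F k = X \<inter> F k" if "k \<in> {1..m}" for k
      using FF[of k] that by auto
    then show ?thesis
      unfolding ind IH(3) F[symmetric]
      by (auto simp: atLeastAtMostSuc_conv Int_absorb2)
  qed
  moreover have g: "ground (P (Suc m)) = F (Suc m)"
    by (simp add: P F free_product_def IH uniform_matroid_def)
  moreover have "rank_of (P (Suc m)) (F (Suc m)) = sum a {1..Suc m}"
    unfolding rank_of_def
  proof (rule Max_eqI)
    fix y assume "y \<in> card ` {I. indep (P (Suc m)) I \<and> I \<subseteq> F (Suc m)}"
    then obtain I where I: "y = card I" "indep (P (Suc m)) I" "I \<subseteq> F (Suc m)" by auto
    have "Suc m \<in> {1..Suc m}" by simp
    then have "card (I \<inter> F (Suc m)) \<le> sum a {1..Suc m}" using I(2) unfolding char by blast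
    then show "y \<le> sum a {1..Suc m}" using I by (simp add: Int_absorb2)
  next
    have "disjoint_family_on E {1..Suc m}"
      by (rule disjoint_family_on_mono[OF _ disj]) (use Suc.prems in auto)
    then obtain X where X: "X \<subseteq> F (Suc m)" "\<And>k. k \<le> Suc m \<Longrightarrow> card (X \<inter> F k) = sum a {1..k}"
      using partial_union_transversal[of E "Suc m" a] card Suc.prems unfolding F_def by auto
    then have "indep (P (Suc m)) X" unfolding char by auto
    moreover have "card X = sum a {1..Suc m}" using X(2)[of "Suc m"] X(1) by (simp add: Int_absorb2)
    ultimately show "sum a {1..Suc m} \<in> card ` {I. indep (P (Suc m)) I \<and> I \<subseteq> F (Suc m)}"
      using X(1) by (metis (mono_tags, lifting) image_eqI mem_Collect_eq)
  qed auto
  ultimately show ?case by simp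
qed

section \<open>Splitting a bound\<close>

lemma matroid_iso_card_indep:
  fixes M N :: "'e::finite matroid"
  assumes "matroid_iso M N" "is_matroid M" "ground M = UNIV" "ground N = UNIV"
  shows "card {X. indep M X} = card {X. indep N X}"
proof -
  obtain f where f: "f permutes UNIV" "N = relabel f M"
    using matroid_iso_obtain_relabel[OF assms(1,3,4)] .
  have "bij_betw ((-`) f) {X. indep N X} {X. indep M X}"
  proof (rule bij_betwI[where g = "(`) f"])
    show "f ` f -` X = X" for X using permutes_surj[OF f(1)] by (rule surj_image_vimage_eq)
    show "f -` f ` X = X" for X using permutes_inj[OF f(1)] by (rule inj_vimage_image_eq)
  qed (auto simp: f(2) inj_vimage_image_eq[OF permutes_inj[OF f(1)]])
  then show ?thesis by (simp add: bij_betw_same_card)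
qed

text \<open>
  Linear independence turns any integral representation into the one picked out by the definite
  description.
\<close>

lemma nested_vector_eqI:
  fixes N :: "'k::finite \<Rightarrow> 'e::finite matroid"
  assumes N: "nested_enumeration r N" and "\<And>j. v $ j \<in> \<int>"
    and v: "\<And>x. sym_indicator (matroid_polytope M) x = (\<Sum>j\<in>UNIV. v $ j * sym_indicator (matroid_polytope (N j)) x)"
  shows "nested_vector N M = v"
  unfolding nested_vector_def
proof (rule the_equality)
  show "(\<forall>j. v $ j \<in> \<int>) \<and> sym_indicator (matroid_polytope M) =
      (\<lambda>x. \<Sum>j\<in>UNIV. v $ j * sym_indicator (matroid_polytope (N j)) x)"
    using assms(2) v by auto
  fix u assume "(\<forall>j. u $ j \<in> \<int>) \<and> sym_indicator (matroid_polytope M) =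
      (\<lambda>x. \<Sum>j\<in>UNIV. u $ j * sym_indicator (matroid_polytope (N j)) x)"
  then have u: "sym_indicator (matroid_polytope M) x =
      (\<Sum>j\<in>UNIV. u $ j * sym_indicator (matroid_polytope (N j)) x)" for x by simp
  have "(\<Sum>j\<in>UNIV. (u $ j - v $ j) * sym_indicator (matroid_polytope (N j)) x) = 0" for x
    using u[of x] v[of x] by (simp add: left_diff_distrib sum_subtractf)
  then have "u $ j - v $ j = 0" for j
    by (rule nested_sym_indicators_independent[OF N])
  then show "u = v" by (simp add: vec_eq_iff)
qed

text \<open>
  The nested matroids \<open>M\<close> and \<open>L\<close> have distinct unit vectors \<open>e\<^sub>j\<close> and \<open>e\<^sub>l\<close> as their vectors, since
  they are not isomorphic. The relation \<open>mid\<close> then gives \<open>K\<close> the vector \<open>2 e\<^sub>j - e\<^sub>l\<close>.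
\<close>

lemma not_extremal_if_midpoint:
  fixes N :: "'k::finite \<Rightarrow> 'e::finite matroid"
  assumes N: "nested_enumeration r N"
    and mat: "M \<in> matroids_of_rank r" "L \<in> matroids_of_rank r" "K \<in> matroids_of_rank r"
    and nest: "nested M" "nested L"
    and card: "card {X. indep M X} \<noteq> card {X. indep L X}"
    and mid: "\<And>x. sym_indicator (matroid_polytope L) x + sym_indicator (matroid_polytope K) x
                = 2 * sym_indicator (matroid_polytope M) x"
  shows "\<not> extremal N M"
proof -
  have Nr: "N j \<in> matroids_of_rank r" for j
    using N unfolding nested_enumeration_def by blast
  have rep: "\<exists>j. matroid_iso A (N j) \<and>
      sym_indicator (matroid_polytope (N j)) = sym_indicator (matroid_polytope A)"
    if A: "A \<in> matroids_of_rank r" "nested A" for A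
  proof -
    obtain j where j: "matroid_iso A (N j)"
      using N A unfolding nested_enumeration_def by blast
    obtain f where "f permutes UNIV" "N j = relabel f A"
      using matroid_iso_obtain_relabel[OF j] A(1) Nr[of j] by (auto simp: matroids_of_rank_def)
    then show ?thesis using j sym_indicator_relabel[OF _ A(1)] by metis
  qed
  obtain j where j: "matroid_iso M (N j)"
      "sym_indicator (matroid_polytope (N j)) = sym_indicator (matroid_polytope M)"
    using rep[OF mat(1) nest(1)] by blast
  obtain l where l: "matroid_iso L (N l)"
      "sym_indicator (matroid_polytope (N l)) = sym_indicator (matroid_polytope L)"
    using rep[OF mat(2) nest(2)] by blast
  have "card {X. indep M X} = card {X. indep (N j) X}" "card {X. indep L X} = card {X. indep (N l) X}"
    using matroid_iso_card_indep[OF j(1)] matroid_iso_card_indep[OF l(1)] mat Nr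
    by (auto simp: matroids_of_rank_def)
  then have "j \<noteq> l" using card by auto
  have unit: "(\<Sum>i\<in>UNIV. axis k 1 $ i * s i) = s k" for k :: 'k and s :: "'k \<Rightarrow> real"
  proof -
    have "(\<Sum>i\<in>UNIV. axis k 1 $ i * s i) = (\<Sum>i\<in>UNIV. if i = k then s i else 0)"
      by (intro sum.cong) (auto simp: axis_def)
    then show ?thesis by simp
  qed
  have axis_Ints: "axis k 1 $ i \<in> (\<int> :: real set)" for k i :: 'k by (simp add: axis_def)
  have vM: "nested_vector N M = axis j 1"
    by (rule nested_vector_eqI[OF N]) (simp_all add: axis_Ints unit j)
  have vL: "nested_vector N L = axis l 1"
    by (rule nested_vector_eqI[OF N]) (simp_all add: axis_Ints unit l)
  have vK: "nested_vector N K = 2 *\<^sub>R axis j 1 - axis l 1"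
  proof (rule nested_vector_eqI[OF N])
    show "(2 *\<^sub>R axis j 1 - axis l 1) $ i \<in> (\<int> :: real set)" for i
      by (simp add: axis_Ints)
    fix x
    show "sym_indicator (matroid_polytope K) x =
        (\<Sum>i\<in>UNIV. (2 *\<^sub>R axis j 1 - axis l 1) $ i * sym_indicator (matroid_polytope (N i)) x)"
      using mid[of x]
      by (simp add: left_diff_distrib sum_subtractf unit j l mult.assoc sum_distrib_left[symmetric])
  qed
  have ne: "nested_vector N L \<noteq> nested_vector N K"
  proof
    assume "nested_vector N L = nested_vector N K"
    then have "(axis l 1 :: real ^ 'k) $ j = (2 *\<^sub>R axis j 1 - axis l 1) $ j" unfolding vL vK by (rule arg_cong)
    then show False using \<open>j \<noteq> l\<close> by (simp add: axis_def)
  qed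
  have "midpoint (nested_vector N L) (nested_vector N K) = nested_vector N M"
    unfolding vM vL vK midpoint_def by simp
  then have "nested_vector N M \<in> open_segment (nested_vector N L) (nested_vector N K)"
    using ne by (metis midpoint_in_open_segment)
  moreover have "nested_vector N A \<in> Omega r N" if "A \<in> matroids_of_rank r" for A
    unfolding Omega_def using that by (intro hull_inc) auto
  moreover have "matroid_rank M = r" using mat(1) unfolding matroids_of_rank_def by blast
  ultimately show ?thesis
    using mat unfolding extremal_def extreme_point_of_def by blast
qed

text \<open>
  By \<open>slack\<close>, the bounds on \<open>A\<close> and \<open>C\<close> give \<open>x(G) + x(H) \<le> 2 g\<close>. If both bounds \<open>g\<close> are
  attained, the bound on \<open>C\<close> is attained too, which makes the combined family directed; and no point of the polytope of \<open>\<C>\<close> exceeds both, so the polytopes of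
  the two one-sided families cover it.
\<close>

lemma capped_two_way_split:
  fixes \<C> :: "('e::finite set \<times> nat) set"
  assumes chain: "caps_chain (insert (G, g) \<C>)" "caps_chain (insert (H, g) \<C>)"
    and r: "(UNIV, r) \<in> \<C>" "r \<le> CARD('e)"
    and co: "\<And>S c. (S, c) \<in> insert (G, g) (insert (H, g) \<C>) \<Longrightarrow> r \<le> c + card (- S)"
    and AC: "(A, p) \<in> \<C>" "(C, q) \<in> \<C>" "A \<subseteq> G \<inter> H" "G \<union> H \<subseteq> C"
    and slack: "p + q + card (G \<inter> H - A) \<le> 2 * g"
  shows "capped \<C> \<in> matroids_of_rank r" (is "?L \<in> _")
    and "capped (insert (G, g) \<C>) \<in> matroids_of_rank r" (is "?M \<in> _")
    and "capped (insert (H, g) \<C>) \<in> matroids_of_rank r" (is "?M' \<in> _")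
    and "capped (insert (G, g) (insert (H, g) \<C>)) \<in> matroids_of_rank r" (is "?K \<in> _")
    and "sym_indicator (matroid_polytope (capped \<C>)) x
         + sym_indicator (matroid_polytope (capped (insert (G, g) (insert (H, g) \<C>)))) x
       = sym_indicator (matroid_polytope (capped (insert (G, g) \<C>))) x
         + sym_indicator (matroid_polytope (capped (insert (H, g) \<C>))) x"
proof -
  have dirG: "tight_directed (insert (G, g) \<C>)" and dirH: "tight_directed (insert (H, g) \<C>)"
    using chain by (auto intro: chain_tight_directed)
  have dir: "tight_directed \<C>"
    using caps_chain_subset[OF chain(1)] by (intro chain_tight_directed) blast
  have dirGH: "tight_directed (insert (G, g) (insert (H, g) \<C>))"
  proof (rule tight_directedI)
    let ?D = "insert (G, g) (insert (H, g) \<C>)"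
    fix X S T
    assume X: "indep (capped ?D) X"
      and S: "(S, card (X \<inter> S)) \<in> ?D" and T: "(T, card (X \<inter> T)) \<in> ?D"
    show "\<exists>U. (U, card (X \<inter> U)) \<in> ?D \<and> S \<subseteq> U \<and> T \<subseteq> U"
    proof (cases "S \<subseteq> T \<or> T \<subseteq> S")
      case True
      then show ?thesis using S T by blast
    next
      case False
      then have "{S, T} = {G, H}" and tight: "card (X \<inter> G) = g" "card (X \<inter> H) = g"
        using S T caps_chainD[OF chain(1), of S _ T] caps_chainD[OF chain(2), of S _ T] by auto
      have cap: "card (X \<inter> A) \<le> p" "card (X \<inter> C) \<le> q"
        using X AC(1,2) by (auto simp: indep_capped)
      have "2 * g = card (X \<inter> G \<union> X \<inter> H) + card ((X \<inter> G) \<inter> (X \<inter> H))"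
        using card_Un_Int[of "X \<inter> G" "X \<inter> H"] tight by simp
      also have "card ((X \<inter> G) \<inter> (X \<inter> H)) \<le> card (X \<inter> A \<union> (G \<inter> H - A))"
        by (rule card_mono) auto
      also have "\<dots> \<le> card (X \<inter> A) + card (G \<inter> H - A)" by (rule card_Un_le)
      also have "card (X \<inter> G \<union> X \<inter> H) \<le> card (X \<inter> C)"
        using AC(4) by (intro card_mono) auto
      finally have "card (X \<inter> C) = q" using cap slack by simp
      moreover have "S \<in> {G, H}" "T \<in> {G, H}" using \<open>{S, T} = {G, H}\<close> by blast+
      then have "S \<subseteq> C" "T \<subseteq> C" using AC(4) by blast+
      ultimately show ?thesis using AC(2) by blast
    qed
  qed
  show L: "?L \<in> matroids_of_rank r" and M: "?M \<in> matroids_of_rank r"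
    and M': "?M' \<in> matroids_of_rank r" and K: "?K \<in> matroids_of_rank r"
    using r co by (auto intro!: capped_in_matroids_of_rank dir dirG dirH dirGH)
  note poly = matroid_polytope_capped[OF dir r(1) L]
    matroid_polytope_capped[OF dirG _ M] matroid_polytope_capped[OF dirH _ M']
    matroid_polytope_capped[OF dirGH _ K]
  have cover: "mass x G \<le> g \<or> mass x H \<le> g" if x: "x \<in> matroid_polytope ?L" for x
  proof (rule ccontr)
    assume "\<not> ?thesis"
    then have "2 * real g < mass x G + mass x H" by simp
    also have "\<dots> = mass x (G \<union> H) + mass x (G \<inter> H)"
      by (rule sum.union_inter[symmetric]) auto
    also have "mass x (G \<inter> H) = mass x A + mass x (G \<inter> H - A)"
      using AC(3) by (simp add: sum.subset_diff)
    also have "mass x (G \<inter> H - A) \<le> card (G \<inter> H - A)"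
      using sum_bounded_above[of "G \<inter> H - A" "($) x" 1] x r(1) by (simp add: poly(1))
    also have "mass x (G \<union> H) \<le> mass x C"
      using x AC(4) by (intro sum_mono2) (auto simp: poly(1))
    also have "mass x A \<le> p" using x AC(1) by (auto simp: poly(1))
    also have "mass x C \<le> q" using x AC(2) by (auto simp: poly(1))
    finally show False using slack by linarith
  qed
  have ind: "indicator (matroid_polytope ?L) y + indicator (matroid_polytope ?K) y
      = (indicator (matroid_polytope ?M) y + indicator (matroid_polytope ?M') y :: real)" for y
  proof -
    have "y \<in> matroid_polytope ?M \<longleftrightarrow> y \<in> matroid_polytope ?L \<and> mass y G \<le> g"
      "y \<in> matroid_polytope ?M' \<longleftrightarrow> y \<in> matroid_polytope ?L \<and> mass y H \<le> g"
      "y \<in> matroid_polytope ?K \<longleftrightarrow> y \<in> matroid_polytope ?L \<and> mass y G \<le> g \<and> mass y H \<le> g"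
      using r(1) by (auto simp: poly)
    then show ?thesis using cover[of y] by (auto simp: indicator_def)
  qed
  show "sym_indicator (matroid_polytope ?L) x + sym_indicator (matroid_polytope ?K) x
      = sym_indicator (matroid_polytope ?M) x + sym_indicator (matroid_polytope ?M') x"
    unfolding sym_indicator_def distrib_left[symmetric] sum.distrib[symmetric] ind ..
qed

lemma obtain_permutes_image:
  assumes "finite V" "A \<subseteq> V" "B \<subseteq> V" "card A = card B"
  obtains f where "f permutes V" "f ` A = B"
proof -
  have fin: "finite A" "finite B" using assms finite_subset by auto
  obtain g where g: "bij_betw g A B"
    using finite_same_card_bij[OF fin assms(4)] by blast
  have "card (V - A) = card (V - B)" using assms fin by (simp add: card_Diff_subset)
  then obtain h where h: "bij_betw h (V - A) (V - B)"
    using finite_same_card_bij[of "V - A" "V - B"] assms(1) by auto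
  define f where "f x = (if x \<in> A then g x else if x \<in> V then h x else x)" for x
  have fA: "bij_betw f A B" using g by (simp add: f_def cong: bij_betw_cong)
  moreover have "bij_betw f (V - A) (V - B)"
    using h by (subst bij_betw_cong[of _ _ h]) (auto simp: f_def)
  ultimately have "bij_betw f (A \<union> (V - A)) (B \<union> (V - B))"
    by (rule bij_betw_combine) auto
  then have "bij_betw f V V" using assms(2,3) by (simp add: Un_absorb1)
  then have "f permutes V"
    by (rule bij_imp_permutes) (use assms(2) in \<open>auto simp: f_def\<close>)
  then show ?thesis using that fA by (simp add: bij_betw_def)
qed

lemma relabel_capped:
  fixes \<C> :: "('e::finite set \<times> nat) set"
  assumes f: "f permutes UNIV"
  shows "relabel f (capped \<C>) = capped ((\<lambda>(S, c). (f ` S, c)) ` \<C>)"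
proof -
  have "card (f -` X \<inter> S) = card (X \<inter> f ` S)" for X S
  proof -
    have "f ` (f -` X \<inter> S) = X \<inter> f ` S" by auto
    moreover have "card (f ` (f -` X \<inter> S)) = card (f -` X \<inter> S)"
      by (rule card_image) (rule permutes_inj_on[OF f])
    ultimately show ?thesis by simp
  qed
  then show ?thesis by (auto simp: relabel_def capped_def fun_eq_iff)
qed

theorem theorem4p10:
  fixes n i :: nat
    and a b :: "nat \<Rightarrow> nat"
    and E :: "nat \<Rightarrow> 'e::finite set"
    and M :: "'e matroid"
    and N :: "'k::finite \<Rightarrow> 'e matroid"
  assumes "\<And>j. j \<in> {1..n} \<Longrightarrow> a j > 0 \<and> b j > 0"
    and "\<And>j. j \<in> {1..n} \<Longrightarrow> card (E j) = a j + b j"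
    and "disjoint_family_on E {1..n}"
    and "(\<Union>j\<in>{1..n}. E j) = UNIV"
    and "M = foldl (\<box>) (uniform_matroid (a 1) (E 1))
               (map (\<lambda>j. uniform_matroid (a j) (E j)) [2..<n + 1])"
    and "nested_enumeration (matroid_rank M) N"
    and "i \<in> {1..n - 1}"
    and "a i \<ge> a (i + 1)"
    and "b (i + 1) \<ge> b i"
  shows "\<not> extremal N M"
proof -
  note pos = assms(1) and cardE = assms(2) and disj = assms(3) and cover = assms(4)
  define F where "F k = (\<Union>j\<in>{1..k}. E j)" for k
  define R where "R k = sum a {1..k}" for k
  define r where "r = R n"
  have i: "1 \<le> i" "Suc i \<le> n" using assms(7) by auto
  have F0: "F 0 = {}" and FSuc: "F (Suc k) = F k \<union> E (Suc k)" for k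
    by (auto simp: F_def atLeastAtMostSuc_conv)
  have R0: "R 0 = 0" and RSuc: "R (Suc k) = R k + a (Suc k)" for k
    by (simp_all add: R_def)
  have Fn: "F n = UNIV" using cover by (simp add: F_def)
  have Fmono: "F k \<subseteq> F l" if "k \<le> l" for k l
    unfolding F_def using that by (intro UN_mono) auto
  have E_disjoint: "E j \<inter> E l = {}" if "j \<in> {1..n}" "l \<in> {1..n}" "j \<noteq> l" for j l
    using disj that by (auto simp: disjoint_family_on_def)
  have select: "\<exists>X. \<forall>k\<le>n. card (X \<inter> F k) = sum t {1..k}"
    if "\<And>j. j \<in> {1..n} \<Longrightarrow> t j \<le> card (E j)" for t
    using partial_union_transversal[OF disj that] unfolding F_def by metis
  have FE: "F k \<inter> E j = {}" if "k < j" "j \<le> n" for k j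
    using E_disjoint[of _ j] that by (fastforce simp: F_def)

  have "n \<noteq> 0" using i by simp
  then have M: "ground M = UNIV" "matroid_rank M = r"
      "\<And>X. indep M X \<longleftrightarrow> (\<forall>k\<in>{1..n}. card (X \<inter> F k) \<le> R k)"
    using iterated_free_product[OF disj, of a n] cardE assms(5) Fn
    unfolding F_def R_def r_def by auto

  \<comment> \<open>The trivial bound on the empty set \<open>F 0\<close> is kept, so that \<open>F (i - 1)\<close> also carries a bound when \<open>i = 1\<close>.\<close>
  define \<C> where "\<C> = {(F k, R k) | k. k \<le> n \<and> k \<noteq> i}"
  define p where "p = i - 1"
  have p: "i = Suc p" using i by (simp add: p_def)
  define A where "A = F p"
  define C where "C = F (Suc i)"
  have Fi: "F i = A \<union> E i" and C: "C = A \<union> (E i \<union> E (Suc i))"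
    using FSuc[of p] FSuc[of i] by (auto simp: A_def C_def p)
  have AE: "A \<inter> E i = {}" "A \<inter> E (Suc i) = {}" "E i \<inter> E (Suc i) = {}"
    using FE[of p i] FE[of p "Suc i"] E_disjoint[of i "Suc i"] i by (auto simp: A_def p)

  have "M = capped (insert (F i, R i) \<C>)"
  proof (rule matroid.equality)
    have "(\<forall>(S, c)\<in>insert (F i, R i) \<C>. card (X \<inter> S) \<le> c) \<longleftrightarrow> (\<forall>k\<le>n. card (X \<inter> F k) \<le> R k)" for X
      using i by (auto simp: \<C>_def)
    moreover have "(\<forall>k\<le>n. card (X \<inter> F k) \<le> R k) \<longleftrightarrow> (\<forall>k\<in>{1..n}. card (X \<inter> F k) \<le> R k)" for X
      using F0 R0 by (metis One_nat_def Suc_leI atLeastAtMost_iff bot_nat_0.not_eq_extremum card.empty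
          inf_bot_right le_numeral_extra(3))
    ultimately show "indep M = indep (capped (insert (F i, R i) \<C>))"
      using M(3) by (auto simp: fun_eq_iff indep_capped)
  qed (simp_all add: M)

  \<comment> \<open>The sizes are chosen so that \<open>D\<close> has as many elements as \<open>E i\<close>, while \<open>slack\<close> below holds with equality.\<close>
  obtain D\<^sub>1 where D1: "D\<^sub>1 \<subseteq> E i" "card D\<^sub>1 = a i - a (Suc i)"
  proof -
    have "a i - a (Suc i) \<le> card (E i)" using cardE[of i] i by simp
    then show ?thesis using that obtain_subset_with_card_n by metis
  qed
  obtain D\<^sub>2 where D2: "D\<^sub>2 \<subseteq> E (Suc i)" "card D\<^sub>2 = b i + a (Suc i)"
  proof -
    have "b i + a (Suc i) \<le> card (E (Suc i))" using cardE[of "Suc i"] i assms(9) by simp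
    then show ?thesis using that obtain_subset_with_card_n by metis
  qed
  define D where "D = D\<^sub>1 \<union> D\<^sub>2"
  have cD: "card D = card (E i)"
    unfolding D_def using D1 D2 AE(3) cardE[of i] i assms(8)
    by (subst card_Un_disjoint) auto
  have DE: "D \<subseteq> E i \<union> E (Suc i)" using D1 D2 by (auto simp: D_def)
  define H where "H = A \<union> D"
  obtain f where f: "f permutes E i \<union> E (Suc i)" "f ` E i = D"
    using obtain_permutes_image[of "E i \<union> E (Suc i)" "E i" D] DE cD by auto
  have fU: "f permutes UNIV" using permutes_subset[OF f(1)] by simp
  have f_below: "f ` F k = F k" if "k < i" for k
  proof -
    have "x \<notin> E i \<union> E (Suc i)" if "x \<in> F k" for x
      using FE[of k i] FE[of k "Suc i"] \<open>k < i\<close> i that by auto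
    then have "f x = x" if "x \<in> F k" for x
      using f(1) that by (simp add: permutes_def)
    then show ?thesis by simp
  qed
  have f_above: "f ` F k = F k" if "i < k" for k
  proof -
    have "E i \<union> E (Suc i) \<subseteq> F k" using Fmono[of "Suc i" k] that C C_def by auto
    then show ?thesis using permutes_image permutes_subset[OF f(1)] by blast
  qed
  have "(\<lambda>(S, c). (f ` S, c)) ` \<C> = \<C>"
  proof -
    have "f ` F k = F k" if "k \<noteq> i" for k
      using f_below[of k] f_above[of k] that by (cases "k < i") auto
    then show ?thesis by (force simp: \<C>_def image_iff)
  qed
  moreover have "f ` F i = H"
  proof -
    have "f ` A = A" using f_below[of p] by (simp add: A_def p)
    then show ?thesis by (simp only: Fi H_def image_Un f(2))
  qed
  ultimately have relabelM: "relabel f (capped (insert (F i, R i) \<C>)) = capped (insert (H, R i) \<C>)"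
    by (simp add: relabel_capped[OF fU])

  \<comment> \<open>\<open>B\<close> is a basis of \<open>M\<close> that makes every bound tight.\<close>
  obtain B where B: "\<And>k. k \<le> n \<Longrightarrow> card (B \<inter> F k) = R k"
    using select[of a] cardE unfolding R_def by auto
  have cB: "card B = r" using B[of n] Fn by (simp add: r_def)
  have co: "r \<le> R k + card (- F k)" if "k \<le> n" for k
  proof -
    have "card B = card (B \<inter> F k) + card (B - F k)" by (rule card_Int_Diff) simp
    moreover have "card (B - F k) \<le> card (- F k)" by (rule card_mono) auto
    ultimately show ?thesis using B[OF that] cB by simp
  qed
  have chain: "caps_chain (insert (F i, R i) \<C>)"
  proof -
    have "F k \<subseteq> F l \<or> F l \<subseteq> F k" for k l using Fmono[of k l] Fmono[of l k] by linarith
    then show ?thesis unfolding caps_chain_def \<C>_def by blast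
  qed
  have chain': "caps_chain (insert (H, R i) \<C>)"
  proof -
    have H: "F k \<subseteq> H \<or> H \<subseteq> F k" if "k \<noteq> i" for k
    proof (cases "k < i")
      case True
      then show ?thesis using Fmono[of k p] by (auto simp: H_def A_def p)
    next
      case False
      then have "C \<subseteq> F k" using Fmono[of "Suc i" k] that by (auto simp: C_def)
      then show ?thesis using DE C by (auto simp: H_def)
    qed
    have "F k \<subseteq> F l \<or> F l \<subseteq> F k" for k l using Fmono[of k l] Fmono[of l k] by linarith
    then show ?thesis using H unfolding caps_chain_def \<C>_def by blast
  qed
  have UNIV: "(UNIV, r) \<in> \<C>" using i Fn by (auto simp: \<C>_def r_def)
  have rcard: "r \<le> CARD('e)" using cB card_mono[of UNIV B] by simp
  have cH: "card (- H) = card (- F i)"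
  proof -
    have "card (f ` F i) = card (F i)" by (rule card_image) (rule permutes_inj_on[OF fU])
    then show ?thesis using \<open>f ` F i = H\<close> by (simp add: Compl_eq_Diff_UNIV card_Diff_subset)
  qed
  have co': "r \<le> c + card (- S)" if "(S, c) \<in> insert (F i, R i) (insert (H, R i) \<C>)" for S c
    using that co[of i] co cH i by (auto simp: \<C>_def)
  have AC: "(A, R p) \<in> \<C>" "(C, R (Suc i)) \<in> \<C>" "A \<subseteq> F i \<inter> H" "F i \<union> H \<subseteq> C"
  proof -
    show "(A, R p) \<in> \<C>" "(C, R (Suc i)) \<in> \<C>"
      using i unfolding \<C>_def A_def C_def by (auto simp: p)
    show "A \<subseteq> F i \<inter> H" "F i \<union> H \<subseteq> C" using DE unfolding Fi H_def C by blast+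
  qed
  have slack: "R p + R (Suc i) + card (F i \<inter> H - A) \<le> 2 * R i"
  proof -
    have "F i \<inter> H - A \<subseteq> D\<^sub>1" using AE D2 by (auto simp: Fi H_def D_def)
    then have "card (F i \<inter> H - A) \<le> a i - a (Suc i)"
      unfolding D1(2)[symmetric] by (rule card_mono[rotated]) simp
    then show ?thesis using RSuc[of p] RSuc[of i] assms(8) by (simp add: p)
  qed
  note split = capped_two_way_split[OF chain chain' UNIV rcard co' AC slack]

  have card: "card {X. indep (capped (insert (F i, R i) \<C>)) X} \<noteq> card {X. indep (capped \<C>) X}"
  proof -
    \<comment> \<open>Moving one element from \<open>E (i + 1)\<close> to \<open>E i\<close> violates the bound on \<open>F i\<close> only.\<close>
    define t where "t j = (if j = i then a i + 1 else if j = Suc i then a j - 1 else a j)" for j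
    have "t j \<le> card (E j)" if "j \<in> {1..n}" for j
      using cardE[OF that] pos[OF that] by (auto simp: t_def)
    then obtain X where X: "\<And>k. k \<le> n \<Longrightarrow> card (X \<inter> F k) = sum t {1..k}"
      using select[of t] by auto
    have "k \<le> n \<Longrightarrow> sum t {1..k} = R k + (if k = i then 1 else 0)" for k
    proof (induction k)
      case 0
      then show ?case using i by (simp add: R0)
    next
      case (Suc k)
      then show ?case using pos[of "Suc i"] i by (auto simp: RSuc t_def)
    qed
    then have X': "card (X \<inter> F k) = R k + (if k = i then 1 else 0)" if "k \<le> n" for k
      using X that by simp
    have "indep (capped \<C>) X" using X' by (auto simp: indep_capped \<C>_def)
    moreover have "\<not> indep (capped (insert (F i, R i) \<C>)) X"
      using X'[of i] i by (simp add: indep_capped)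
    moreover have "indep (capped \<C>) Y" if "indep (capped (insert (F i, R i) \<C>)) Y" for Y
      using that by (simp add: indep_capped)
    ultimately have "{X. indep (capped (insert (F i, R i) \<C>)) X} \<subset> {X. indep (capped \<C>) X}" by blast
    then have "card {X. indep (capped (insert (F i, R i) \<C>)) X} < card {X. indep (capped \<C>) X}"
      by (rule psubset_card_mono[rotated]) simp
    then show ?thesis by simp
  qed
  have "caps_chain \<C>" by (rule caps_chain_subset[OF chain]) blast
  then have nested: "nested (capped (insert (F i, R i) \<C>))" "nested (capped \<C>)"
    using chain by (auto intro: chain_capped_nested)
  have mid: "sym_indicator (matroid_polytope (capped \<C>)) x
      + sym_indicator (matroid_polytope (capped (insert (F i, R i) (insert (H, R i) \<C>)))) x
      = 2 * sym_indicator (matroid_polytope (capped (insert (F i, R i) \<C>))) x" for x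
    using split(5)[of x] sym_indicator_relabel[OF fU split(2)] by (simp add: relabelM)
  have "nested_enumeration r N" using assms(6) M(2) by simp
  from not_extremal_if_midpoint[OF this split(2) split(1) split(4) nested card mid]
  show ?thesis using \<open>M = capped (insert (F i, R i) \<C>)\<close> by simp
qed

end
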